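(* Let $k$ be a non-Archimedean valued field and let $F$ be the parametric form, over $k$, of the reduced non-Archimedean discriminant amoeba of a collection $A$ of $n+m+1$ points of $\mathbb{Z}^n$ in general position (all notation as in the context). Let $T$ be the collection of all $I=\{i_1,\dots,i_{m-1}\}\subset\{1,\dots,n+m+1\}$ with $i_j<i_{j+1}$ for $j<m-1$ such that the common zero set of $f_{i_1},\dots,f_{i_{m-1}}$ in $k^{m-1}$ consists of a unique point. For $I\in T$ let $F_I$ be $F$ under the linear change of variables making $f_{i_j}=x_j$ for $j=1,\dots,m-1$, and let $\phi_{F_I}$ be the tropicalization of $F_I$. Then $$\overline{F(k^{m-1})}=\bigcup_{I\in T}\phi_{F_I}(\mathbb{R}^{m-1}).$$
   Context: Field: $k$ is a non-Archimedean valued field with valuation $v$, real-valued on nonzero elements, with $v(0)=+\infty$. Integers are regarded as elements of $k$. Support and matrix $B$: $A=\{a_1,\dots,a_{n+m+1}\}\subset\mathbb{Z}^n$ is a collection of $n+m+1$ points in general position (generic), with $m\ge 0$ (the map $F$ below presupposes $m\ge1$). Let $\hat A\in\mathbb{Z}^{(n+1)\times(n+m+1)}$ be the matrix whose $i$-th column is $\binom{1}{a_i}$. Let $B=(\beta_{i,j})\in\mathbb{Z}^{(n+m+1)\times m}$ be a matrix whose columns form a basis of the right (integer) null space of $\hat A$. The map $F$: for $1\le i\le n+m+1$ let $$f_i(x_1,\dots,x_{m-1})=\beta_{i,1}x_1+\cdots+\beta_{i,m-1}x_{m-1}+\beta_{i,m}.$$ $F$ is the map from $k^{m-1}$ to $\mathbb{R}^m$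 whose $\ell$-th coordinate is $\sum_{i=1}^{n+m+1}\beta_{i,\ell}\,v(f_i(x))$; it is well defined at those $x$ with $f_i(x)\ne0$ for all $i$, and $F(k^{m-1})$ denotes the image of the set of such points. The bar denotes closure in $\mathbb{R}^m$. Change of variables: for $I\in T$ there is an affine-linear change of variables on $k^{m-1}$ (Gauss–Jordan elimination) under which $f_{i_j}$ becomes the coordinate $x_j$ for $j=1,\dots,m-1$. Under it, each $f_i$ becomes $f_i^*(x)=\beta^*_{i,1}x_1+\cdots+\beta^*_{i,m-1}x_{m-1}+\beta^*_{i,m}$ with $\beta^*_{i,j}\in k$, and $F_I$ is the map whose $\ell$-th coordinate is $\sum_{i=1}^{n+m+1}\beta_{i,\ell}\,v(f_i^*(x))$ (the outer coefficients $\beta_{i,\ell}$ are not changed). Tropicalization: $\phi_{F_I}:\mathbb{R}^{m-1}\to\mathbb{R}^m$ is the map whose $\ell$-th coordinate at $r=(r_1,\dots,r_{m-1})$ is $$\sum_{i=1}^{n+m+1}\beta_{i,\ell}\,\min\{v(\beta^*_{i,1})+r_1,\dots,v(\beta^*_{i,m-1})+r_{m-1},\,v(\beta^*_{i,m})\},$$ where terms equal to $+\infty$ are ignored in the minimum.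
   Formalization: For m ≥ 2 the value group v(k* ) is assumed dense in R (over Q_p the left side is discrete while the right side contains a curve), and no f_i may vanish identically over k (otherwise F has empty domain and the minimum in the tropicalization is undefined). *)

theory Defs
  imports "HOL-Analysis.Analysis"
begin

text \<open>
  All indices start at 0. Throughout, \<open>N\<close> is the number of points (that is, n + m + 1), and a vector
  of length \<open>d\<close> over \<open>k\<close> or over the reals is a function on \<open>nat\<close> that vanishes from index \<open>d\<close> on;
  for the reals this is the library's \<open>Euclidean_space d\<close>.
\<close>

definition nonarch_valuation :: "('k::field \<Rightarrow> ereal) \<Rightarrow> bool" where
  "nonarch_valuation v \<longleftrightarrow>
     (\<forall>x. v x \<noteq> -\<infinity>) \<and> (\<forall>x. v x = \<infinity> \<longleftrightarrow> x = 0) \<and>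
     (\<forall>x y. v (x * y) = v x + v y) \<and>
     (\<forall>x y. min (v x) (v y) \<le> v (x + y))"

definition real_point :: "int ^ 'n \<Rightarrow> real ^ 'n" where
  "real_point u = (\<chi> j. real_of_int (u $ j))"

definition general_position :: "nat \<Rightarrow> (nat \<Rightarrow> int ^ 'n) \<Rightarrow> bool" where
  "general_position N a \<longleftrightarrow>
     inj_on a {..<N} \<and>
     (\<forall>S \<subseteq> {..<N}. card S = CARD('n) + 1 \<longrightarrow> \<not> affine_dependent ((real_point \<circ> a) ` S))"

text \<open>The row \<open>None\<close> is the row of ones on top of the matrix whose columns are the points.\<close>

definition hat_matrix :: "(nat \<Rightarrow> int ^ 'n) \<Rightarrow> 'n option \<Rightarrow> nat \<Rightarrow> int" where
  "hat_matrix a r i = (case r of None \<Rightarrow> 1 | Some j \<Rightarrow> a i $ j)"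

definition null_lattice :: "nat \<Rightarrow> (nat \<Rightarrow> int ^ 'n) \<Rightarrow> (nat \<Rightarrow> int) set" where
  "null_lattice N a =
     {u. (\<forall>i\<ge>N. u i = 0) \<and> (\<forall>r. (\<Sum>i<N. hat_matrix a r i * u i) = 0)}"

definition column :: "nat \<Rightarrow> (nat \<Rightarrow> nat \<Rightarrow> int) \<Rightarrow> nat \<Rightarrow> nat \<Rightarrow> int" where
  "column N \<beta> j = (\<lambda>i. if i < N then \<beta> i j else 0)"

definition columns_basis_of_null_lattice ::
  "nat \<Rightarrow> nat \<Rightarrow> (nat \<Rightarrow> int ^ 'n) \<Rightarrow> (nat \<Rightarrow> nat \<Rightarrow> int) \<Rightarrow> bool" where
  "columns_basis_of_null_lattice N m a \<beta> \<longleftrightarrow>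
     (\<forall>j<m. column N \<beta> j \<in> null_lattice N a) \<and>
     (\<forall>u \<in> null_lattice N a. \<exists>c. \<forall>i. u i = (\<Sum>j<m. c j * column N \<beta> j i)) \<and>
     (\<forall>c. (\<forall>i. (\<Sum>j<m. c j * column N \<beta> j i) = 0) \<longrightarrow> (\<forall>j<m. c j = 0))"

definition kspace :: "nat \<Rightarrow> (nat \<Rightarrow> 'k::field) set" where
  "kspace d = {x. \<forall>j\<ge>d. x j = 0}"

text \<open>The affine form \<open>f\<^sub>i\<close> in \<open>m - 1\<close> variables; column \<open>m - 1\<close> of \<open>b\<close> holds the constant terms.\<close>

definition aff_form :: "nat \<Rightarrow> (nat \<Rightarrow> nat \<Rightarrow> 'k::field) \<Rightarrow> nat \<Rightarrow> (nat \<Rightarrow> 'k) \<Rightarrow> 'k" where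
  "aff_form m b i x = (\<Sum>j<m-1. b i j * x j) + b i (m-1)"

definition form_domain :: "nat \<Rightarrow> nat \<Rightarrow> (nat \<Rightarrow> nat \<Rightarrow> 'k::field) \<Rightarrow> (nat \<Rightarrow> 'k) set" where
  "form_domain N m b = {x \<in> kspace (m-1). \<forall>i<N. aff_form m b i x \<noteq> 0}"

text \<open>
  The outer integer coefficients \<open>\<beta>\<close> are kept apart from the coefficients \<open>b\<close> of the affine forms:
  a change of variables affects only the latter.
\<close>

definition param_map ::
  "('k::field \<Rightarrow> ereal) \<Rightarrow> nat \<Rightarrow> nat \<Rightarrow> (nat \<Rightarrow> nat \<Rightarrow> int) \<Rightarrow> (nat \<Rightarrow> nat \<Rightarrow> 'k)
     \<Rightarrow> (nat \<Rightarrow> 'k) \<Rightarrow> nat \<Rightarrow> real" where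
  "param_map v N m \<beta> b x =
     (\<lambda>l. if l < m
           then \<Sum>i<N. real_of_int (\<beta> i l) * real_of_ereal (v (aff_form m b i x))
           else 0)"

text \<open>
  The minimum is taken in \<open>ereal\<close>, so coefficients of valuation \<open>\<infinity>\<close> do not contribute to it unless
  the whole form vanishes identically.
\<close>

definition trop_form ::
  "('k::field \<Rightarrow> ereal) \<Rightarrow> nat \<Rightarrow> (nat \<Rightarrow> nat \<Rightarrow> 'k) \<Rightarrow> nat \<Rightarrow> (nat \<Rightarrow> real) \<Rightarrow> ereal" where
  "trop_form v m b i r = Min (insert (v (b i (m-1))) ((\<lambda>j. v (b i j) + ereal (r j)) ` {..<m-1}))"

text \<open>Tropicalization of \<open>param_map v N m \<beta> b\<close>.\<close>

definition trop_map ::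
  "('k::field \<Rightarrow> ereal) \<Rightarrow> nat \<Rightarrow> nat \<Rightarrow> (nat \<Rightarrow> nat \<Rightarrow> int) \<Rightarrow> (nat \<Rightarrow> nat \<Rightarrow> 'k)
     \<Rightarrow> (nat \<Rightarrow> real) \<Rightarrow> nat \<Rightarrow> real" where
  "trop_map v N m \<beta> b r =
     (\<lambda>l. if l < m
           then \<Sum>i<N. real_of_int (\<beta> i l) * real_of_ereal (trop_form v m b i r)
           else 0)"

definition chart_sets :: "nat \<Rightarrow> nat \<Rightarrow> (nat \<Rightarrow> nat \<Rightarrow> 'k::field) \<Rightarrow> nat set set" where
  "chart_sets N m b =
     {I. I \<subseteq> {..<N} \<and> card I = m - 1 \<and>
         (\<exists>!x. x \<in> kspace (m-1) \<and> (\<forall>i\<in>I. aff_form m b i x = 0))}"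

text \<open>The new coordinates: the \<open>j\<close>-th one is the form indexed by the \<open>j\<close>-th smallest element of \<open>I\<close>.\<close>

definition chart_coords ::
  "nat \<Rightarrow> (nat \<Rightarrow> nat \<Rightarrow> 'k::field) \<Rightarrow> nat set \<Rightarrow> (nat \<Rightarrow> 'k) \<Rightarrow> nat \<Rightarrow> 'k" where
  "chart_coords m b I x = (\<lambda>j. if j < m - 1 then aff_form m b (sorted_list_of_set I ! j) x else 0)"

text \<open>
  Coefficients of the forms rewritten in the new coordinates. For \<open>I \<in> chart_sets N m b\<close> the map
  \<open>chart_coords m b I\<close> is an affine bijection of \<open>kspace (m-1)\<close>, so that such coefficients exist and
  are determined in all rows below \<open>N\<close> and columns below \<open>m\<close>; no other entries are ever used.
\<close>

definition chart_coeffs ::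
  "nat \<Rightarrow> nat \<Rightarrow> (nat \<Rightarrow> nat \<Rightarrow> 'k::field) \<Rightarrow> nat set \<Rightarrow> nat \<Rightarrow> nat \<Rightarrow> 'k" where
  "chart_coeffs N m b I =
     (SOME c. \<forall>i<N. \<forall>x \<in> kspace (m-1). aff_form m c i (chart_coords m b I x) = aff_form m b i x)"

end

theory Submission
  imports Defs
begin

text \<open>
  For \<open>x\<close> in the domain, rescale each form to take the value \<open>1\<close> at \<open>x\<close>. The linear parts of the
  rescaled forms generate a module over the valuation ring, which has a basis \<open>I\<close> among the generators,
  so \<open>v(f\<^sub>i(x)) \<le> v(\<beta>\<^sup>*\<^sub>i\<^sub>j) + v(f\<^sub>i\<^sub>j(x))\<close> for all \<open>i\<close> and \<open>j\<close>. The ultrametric inequality bounds the valuation of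
  the constant term in the same way and turns the minimum of all these values into \<open>v(f\<^sub>i(x))\<close>. Hence
  \<open>F(x)\<close> lies on the tropical image of the chart \<open>I\<close>. These images are finite unions of linear
  projections of polyhedra, so they are closed. Conversely, by density of the value group a tropical point can
  be approximated by points whose coordinates are valuations for which no minimum is attained
  twice; there the tropicalization agrees with \<open>F\<^sub>I\<close>.
\<close>

section \<open>Linear systems and saturated lattices\<close>

text \<open>Elimination by cross-multiplication instead of division, so that one lemma serves both
  the integers, where it yields null lattice vectors, and the field \<open>k\<close>.\<close>

lemma nontrivial_solution:
  fixes A :: "'e \<Rightarrow> 's \<Rightarrow> 'r::idom"
  assumes "finite E" and "finite S" and "card E < card S"
  shows "\<exists>u. (\<exists>s\<in>S. u s \<noteq> 0) \<and> (\<forall>e\<in>E. (\<Sum>s\<in>S. A e s * u s) = 0)"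
  using assms
proof (induction E arbitrary: S A rule: finite_induct)
  case empty
  then have "S \<noteq> {}" by auto
  then show ?case by (auto intro!: exI[of _ "\<lambda>_. 1"])
next
  case (insert e E)
  show ?case
  proof (cases "\<forall>s\<in>S. A e s = 0")
    case True
    have "card E < card S" using insert.prems insert.hyps by simp
    from insert.IH[OF insert.prems(1) this, of A] True show ?thesis by auto
  next
    case False
    then obtain t where t: "t \<in> S" "A e t \<noteq> 0" by auto
    define A' where "A' = (\<lambda>e' s. A e t * A e' s - A e' t * A e s)"
    have "card E < card (S - {t})" using insert.prems insert.hyps t by simp
    from insert.IH[OF _ this, of A'] insert.prems obtain u where
      u: "\<exists>s\<in>S - {t}. u s \<noteq> 0" "\<And>e'. e' \<in> E \<Longrightarrow> (\<Sum>s\<in>S - {t}. A' e' s * u s) = 0" by auto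
    \<comment> \<open>Scaling the smaller solution by the pivot \<open>A e t\<close> lets equation
      \<open>e\<close> determine the entry at \<open>t\<close> without division; in a domain the
      scaled entries stay nonzero.\<close>
    define w where "w = (\<lambda>s. if s = t then - (\<Sum>s\<in>S - {t}. A e s * u s) else A e t * u s)"
    have sum_w: "(\<Sum>s\<in>S. A e' s * w s) = (\<Sum>s\<in>S - {t}. A' e' s * u s)" for e'
    proof -
      have "(\<Sum>s\<in>S. A e' s * w s) = A e' t * w t + (\<Sum>s\<in>S - {t}. A e' s * w s)"
        using insert.prems t by (simp add: sum.remove)
      also have "(\<Sum>s\<in>S - {t}. A e' s * w s) = (\<Sum>s\<in>S - {t}. A e' s * (A e t * u s))"
        by (rule sum.cong) (auto simp: w_def)
      finally show ?thesis
        by (simp add: w_def A'_def algebra_simps sum_subtractf sum_distrib_left)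
    qed
    have "(\<Sum>s\<in>S. A e' s * w s) = 0" if "e' \<in> insert e E" for e'
      using that u(2) by (auto simp: sum_w A'_def)
    moreover have "\<exists>s\<in>S. w s \<noteq> 0" using u(1) t by (auto simp: w_def)
    ultimately show ?thesis by blast
  qed
qed

text \<open>A combination dividing all entries is their gcd up to sign; entries are added one at a
  time by the two-term Bezout identity.\<close>

lemma integer_bezout:
  fixes f :: "nat \<Rightarrow> int"
  shows "\<exists>c. \<forall>i<n. (\<Sum>i<n. c i * f i) dvd f i"
proof (induction n)
  case (Suc n)
  then obtain c where c: "\<And>i. i < n \<Longrightarrow> (\<Sum>i<n. c i * f i) dvd f i" by blast
  define s where "s = (\<Sum>i<n. c i * f i)"
  obtain p q where pq: "p * s + q * f n = gcd s (f n)" using bezout_int by blast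
  define c' where "c' = (\<lambda>i. if i < n then p * c i else q)"
  have "(\<Sum>i<Suc n. c' i * f i) = gcd s (f n)"
    using pq by (simp add: c'_def s_def sum_distrib_left mult.assoc)
  moreover have "gcd s (f n) dvd f i" if "i < Suc n" for i
    using that c[of i] by (cases "i = n") (auto simp: s_def intro: dvd_trans)
  ultimately show ?case by metis
qed auto

text \<open>
  The hypothesis says that the columns of \<open>B\<close> span a saturated sublattice of rank \<open>m\<close>. It keeps them
  independent over every ring, in particular over fields of positive characteristic.
\<close>

lemma saturated_columns_injective:
  fixes B :: "nat \<Rightarrow> nat \<Rightarrow> int" and y :: "nat \<Rightarrow> 'k::comm_ring_1"
  assumes "\<And>u d. \<forall>i<n. d dvd (\<Sum>j<m. B i j * u j) \<Longrightarrow> \<forall>j<m. d dvd u j"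
    and "\<forall>i<n. (\<Sum>j<m. of_int (B i j) * y j) = 0"
  shows "\<forall>j<m. y j = 0"
  using assms
proof (induction m arbitrary: B)
  case (Suc m)
  note sat = Suc.prems(1)
  \<comment> \<open>Saturation tested on the last unit vector: only units divide the whole last
    column, so the gcd of its entries is a unit.\<close>
  have unit: "d dvd 1" if "\<forall>i<n. d dvd B i m" for d
    using sat[of d "\<lambda>j. if j = m then 1 else 0"] that by auto
  obtain c0 where "\<forall>i<n. (\<Sum>i<n. c0 i * B i m) dvd B i m" using integer_bezout[of n "\<lambda>i. B i m"] by blast
  define s where "s = (\<Sum>i<n. c0 i * B i m)"
  have "s dvd 1" using unit \<open>\<forall>i<n. _ dvd B i m\<close> by (simp add: s_def)
  then have "\<bar>s\<bar> = 1" by simp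
  then have ss: "s * s = 1" by (metis abs_mult_self_eq mult_1)
  \<comment> \<open>Since \<open>s\<close> is 1 or -1, the extra factor \<open>s\<close> normalizes
    the combination of the last column to exactly 1.\<close>
  define c where "c = (\<lambda>i. s * c0 i)"
  have c1: "(\<Sum>i<n. c i * B i m) = 1"
    using ss by (simp add: c_def s_def[symmetric] mult.assoc sum_distrib_left[symmetric])
  \<comment> \<open>Combining the equations with weights \<open>c\<close> solves for
    \<open>y m\<close> in terms of the other unknowns. The column operation giving \<open>B'\<close>
    carries out this substitution in the matrix.\<close>
  define t where "t = (\<lambda>j. \<Sum>i<n. c i * B i j)"
  define B' where "B' = (\<lambda>i j. B i j - t j * B i m)"
  have tk: "y m = - (\<Sum>j<m. of_int (t j) * y j)"
  proof -
    have "0 = (\<Sum>i<n. of_int (c i) * (\<Sum>j<Suc m. of_int (B i j) * y j))"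
      using Suc.prems(2) by simp
    also have "\<dots> = (\<Sum>j<Suc m. of_int (t j) * y j)"
      unfolding t_def sum_distrib_left of_int_sum sum_distrib_right
      by (subst sum.swap) (simp add: mult.assoc)
    also have "\<dots> = (\<Sum>j<m. of_int (t j) * y j) + y m"
    proof -
      have "t m = 1" using c1 by (simp add: t_def)
      then show ?thesis by simp
    qed
    finally show ?thesis by (simp add: eq_neg_iff_add_eq_0 add.commute)
  qed
  have "\<forall>j<m. y j = 0"
  proof (rule Suc.IH)
    fix u d assume d: "\<forall>i<n. d dvd (\<Sum>j<m. B' i j * u j)"
    \<comment> \<open>The last entry compensates for the column operation, so saturation passes from
      \<open>B\<close> to \<open>B'\<close>.\<close>
    define u' where "u' = (\<lambda>j. if j = m then - (\<Sum>j<m. t j * u j) else u j)"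
    have "(\<Sum>j<Suc m. B i j * u' j) = (\<Sum>j<m. B' i j * u j)" for i
      by (simp add: u'_def B'_def sum_subtractf algebra_simps sum_distrib_left)
    with d have "\<forall>i<n. d dvd (\<Sum>j<Suc m. B i j * u' j)" by simp
    from sat[OF this] show "\<forall>j<m. d dvd u j" by (auto simp: u'_def less_Suc_eq)
  next
    have "(\<Sum>j<m. of_int (B' i j) * y j) = (\<Sum>j<Suc m. of_int (B i j) * y j)" for i
      by (simp add: tk B'_def sum_subtractf algebra_simps sum_distrib_left)
    then show "\<forall>i<n. (\<Sum>j<m. of_int (B' i j) * y j) = 0" using Suc.prems(2) by simp
  qed
  with tk show ?case by (auto simp: less_Suc_eq)
qed simp

lemma null_lattice_expand:
  assumes "columns_basis_of_null_lattice N m a \<beta>" and "u \<in> null_lattice N a"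
  shows "\<exists>c. \<forall>i. u i = (\<Sum>j<m. c j * column N \<beta> j i)"
  using assms by (simp add: columns_basis_of_null_lattice_def)

text \<open>Null lattices are saturated: if \<open>d\<close> is nonzero and divides a lattice
  vector, the quotient \<open>w\<close> still satisfies the integer equations, and its coordinates
  in the basis exhibit the divisibility. For \<open>d = 0\<close> saturation is independence over
  the integers.\<close>

lemma null_basis_injective:
  fixes y :: "nat \<Rightarrow> 'k::comm_ring_1"
  assumes B: "columns_basis_of_null_lattice N m a \<beta>"
    and y: "\<forall>i<N. (\<Sum>j<m. of_int (\<beta> i j) * y j) = 0"
  shows "\<forall>j<m. y j = 0"
proof (rule saturated_columns_injective[OF _ y])
  fix u :: "nat \<Rightarrow> int" and d assume d: "\<forall>i<N. d dvd (\<Sum>j<m. \<beta> i j * u j)"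
  have indep: "\<forall>j<m. c j = 0" if "\<And>i. i < N \<Longrightarrow> (\<Sum>j<m. c j * \<beta> i j) = 0" for c
  proof -
    have "(\<Sum>j<m. c j * column N \<beta> j i) = 0" for i
      using that by (cases "i < N") (simp_all add: column_def)
    then show ?thesis using B unfolding columns_basis_of_null_lattice_def by blast
  qed
  show "\<forall>j<m. d dvd u j"
  proof (cases "d = 0")
    case True
    then show ?thesis using indep[of u] d by (simp add: mult.commute)
  next
    case False
    define w where "w = (\<lambda>i. if i < N then (\<Sum>j<m. \<beta> i j * u j) div d else 0)"
    have dw: "d * w i = (\<Sum>j<m. \<beta> i j * u j)" if "i < N" for i
      using d that by (simp add: w_def)
    have col: "(\<Sum>i<N. hat_matrix a r i * \<beta> i j) = 0" if "j < m" for r j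
      using B that by (simp add: columns_basis_of_null_lattice_def null_lattice_def column_def)
    have "(\<Sum>i<N. hat_matrix a r i * w i) = 0" for r
    proof -
      have "d * (\<Sum>i<N. hat_matrix a r i * w i) = (\<Sum>i<N. hat_matrix a r i * (d * w i))"
        by (simp add: sum_distrib_left ac_simps)
      also have "\<dots> = (\<Sum>i<N. \<Sum>j<m. u j * (hat_matrix a r i * \<beta> i j))"
        by (simp add: dw sum_distrib_left ac_simps)
      also have "\<dots> = (\<Sum>j<m. u j * (\<Sum>i<N. hat_matrix a r i * \<beta> i j))"
        by (subst sum.swap) (simp add: sum_distrib_left)
      also have "\<dots> = 0" using col by simp
      finally show ?thesis using False by simp
    qed
    then have "w \<in> null_lattice N a" by (simp add: null_lattice_def w_def)
    then obtain c where c: "\<And>i. w i = (\<Sum>j<m. c j * column N \<beta> j i)"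
      using null_lattice_expand[OF B] by blast
    have "(\<Sum>j<m. (u j - d * c j) * \<beta> i j) = 0" if "i < N" for i
    proof -
      have "(\<Sum>j<m. (u j - d * c j) * \<beta> i j) = (\<Sum>j<m. \<beta> i j * u j) - d * w i"
        using that by (simp add: c column_def algebra_simps sum_subtractf sum_distrib_left)
      then show ?thesis using dw[OF that] by simp
    qed
    from indep[OF this] show ?thesis by simp
  qed
qed

text \<open>A zero row makes every null vector vanish at \<open>i\<close>. But any n + 2 indices
  containing \<open>i\<close> carry a nontrivial integer relation; with coefficient 0 at
  \<open>i\<close> it becomes an affine dependence of n + 1 points, against general
  position.\<close>

lemma null_basis_row_nonzero:
  fixes a :: "nat \<Rightarrow> int ^ 'n"
  assumes B: "columns_basis_of_null_lattice N m a \<beta>" and gen: "general_position N a"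
    and N: "CARD('n) + 2 \<le> N" and i: "i < N"
  shows "\<exists>j<m. \<beta> i j \<noteq> 0"
proof (rule ccontr)
  assume zero: "\<not> (\<exists>j<m. \<beta> i j \<noteq> 0)"
  obtain S' where S': "S' \<subseteq> {..<N} - {i}" "card S' = CARD('n) + 1" "finite S'"
  proof -
    have "CARD('n) + 1 \<le> card ({..<N} - {i})" using N i by simp
    then show ?thesis using that by (rule obtain_subset_with_card_n)
  qed
  define S where "S = insert i S'"
  have S: "finite S" "card S = CARD('n) + 2" "S \<subseteq> {..<N}" "i \<in> S" "S - {i} = S'"
    using S' i by (auto simp: S_def card_insert_if)
  have "\<exists>u. (\<exists>s\<in>S. u s \<noteq> 0) \<and> (\<forall>r\<in>UNIV. (\<Sum>s\<in>S. hat_matrix a r s * u s) = 0)"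
    by (rule nontrivial_solution) (use S in \<open>simp_all add: card_UNIV_option\<close>)
  then obtain u0 where u0: "\<exists>s\<in>S. u0 s \<noteq> 0" "\<And>r. (\<Sum>s\<in>S. hat_matrix a r s * u0 s) = 0" by auto
  define u where "u = (\<lambda>s. if s \<in> S then u0 s else 0)"
  have null_eq: "(\<Sum>s\<in>S. hat_matrix a r s * u s) = 0" for r
    using u0(2)[of r] by (simp add: u_def cong: sum.cong)
  have "(\<Sum>s<N. hat_matrix a r s * u s) = (\<Sum>s\<in>S. hat_matrix a r s * u s)" for r
    by (rule sum.mono_neutral_right) (use S in \<open>auto simp: u_def\<close>)
  then have "u \<in> null_lattice N a" using S null_eq by (auto simp: null_lattice_def u_def)
  from null_lattice_expand[OF B this] obtain c where c: "\<And>i. u i = (\<Sum>j<m. c j * column N \<beta> j i)"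
    by blast
  have ui: "u i = 0" using zero i by (simp add: c column_def)
  have null_eq': "(\<Sum>s\<in>S'. hat_matrix a r s * u s) = 0" for r
    using null_eq[of r] ui S by (simp add: sum.remove[of S i])
  have inj: "inj_on (real_point \<circ> a) S'"
  proof (rule comp_inj_on)
    show "inj_on a S'" using gen S' unfolding general_position_def by (blast intro: inj_on_subset)
    show "inj_on real_point (a ` S')" by (auto simp: inj_on_def real_point_def vec_eq_iff)
  qed
  \<comment> \<open>Affine dependence concerns sets of points, so the coefficients are moved from
    indices to points along the injection.\<close>
  define q where "q = (\<lambda>p. real_of_int (u (the_inv_into S' (real_point \<circ> a) p)))"
  have q: "q (real_point (a s)) = u s" if "s \<in> S'" for s
    using the_inv_into_f_f[OF inj that] by (simp add: q_def)
  have "affine_dependent ((real_point \<circ> a) ` S')"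
    unfolding affine_dependent_explicit_finite[OF finite_imageI[OF S'(3)]]
  proof (intro exI[of _ q] conjI)
    have "sum q ((real_point \<circ> a) ` S') = (\<Sum>s\<in>S'. real_of_int (u s))"
      by (subst sum.reindex[OF inj]) (simp add: q)
    also have "\<dots> = 0" using null_eq'[of None] by (simp add: hat_matrix_def flip: of_int_sum)
    finally show "sum q ((real_point \<circ> a) ` S') = 0" .
    obtain s where "s \<in> S" "u s \<noteq> 0" using u0(1) by (auto simp: u_def)
    with ui S have "s \<in> S'" "u s \<noteq> 0" by auto
    then show "\<exists>p\<in>(real_point \<circ> a) ` S'. q p \<noteq> 0" using q by force
    have "(\<Sum>s\<in>S'. real_of_int (u s) *\<^sub>R real_point (a s)) $ j = 0" for j
    proof -
      have "(\<Sum>s\<in>S'. real_of_int (u s) *\<^sub>R real_point (a s)) $ j =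
        real_of_int (\<Sum>s\<in>S'. hat_matrix a (Some j) s * u s)"
        by (simp add: real_point_def hat_matrix_def ac_simps)
      then show ?thesis using null_eq'[of "Some j"] by simp
    qed
    then show "(\<Sum>p\<in>(real_point \<circ> a) ` S'. q p *\<^sub>R p) = 0"
      by (subst sum.reindex[OF inj]) (simp add: q vec_eq_iff)
  qed
  then show False using gen S' unfolding general_position_def by auto
qed

section \<open>Charts\<close>

text \<open>The system is homogenized by an extra unknown with column \<open>- z\<close>. Then
  \<open>d\<close> equations in \<open>d + 1\<close> unknowns have a nontrivial solution, and
  injectivity keeps its extra entry nonzero, so one can divide by it.\<close>

lemma injective_system_surjective:
  fixes M :: "nat \<Rightarrow> nat \<Rightarrow> 'k::field"
  assumes I: "finite I" "card I = d"
    and inj: "\<And>y. \<forall>i\<in>I. (\<Sum>j<d. M i j * y j) = 0 \<Longrightarrow> \<forall>j<d. y j = 0"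
  shows "\<exists>x\<in>kspace d. \<forall>i\<in>I. (\<Sum>j<d. M i j * x j) = z i"
proof -
  define A where "A = (\<lambda>i j. if j = d then - z i else M i j)"
  have "\<exists>u. (\<exists>j\<in>{..d}. u j \<noteq> 0) \<and> (\<forall>i\<in>I. (\<Sum>j\<in>{..d}. A i j * u j) = 0)"
    by (rule nontrivial_solution) (use I in auto)
  then obtain u where u: "\<exists>j\<le>d. u j \<noteq> 0" "\<And>i. i \<in> I \<Longrightarrow> (\<Sum>j\<le>d. A i j * u j) = 0" by auto
  have eq: "(\<Sum>j<d. M i j * u j) = z i * u d" if "i \<in> I" for i
    using u(2)[OF that] by (simp add: A_def lessThan_Suc_atMost[symmetric])
  have "u d \<noteq> 0"
  proof
    assume "u d = 0"
    have "\<forall>j<d. u j = 0" by (rule inj) (simp add: eq \<open>u d = 0\<close>)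
    with \<open>u d = 0\<close> u(1) show False by (metis le_neq_implies_less)
  qed
  define x where "x = (\<lambda>j. if j < d then u j / u d else 0)"
  have "(\<Sum>j<d. M i j * x j) = (\<Sum>j<d. M i j * u j) / u d" for i
    by (simp add: x_def sum_divide_distrib)
  then show ?thesis using eq \<open>u d \<noteq> 0\<close> by (intro bexI[of _ x]) (auto simp: x_def kspace_def)
qed

text \<open>Injectivity of the square linear part gives existence of the common zero, and applied to
  differences it gives uniqueness.\<close>

lemma chart_setsI:
  fixes b :: "nat \<Rightarrow> nat \<Rightarrow> 'k::field"
  assumes I: "I \<subseteq> {..<N}" "card I = m - 1"
    and inj: "\<And>y. \<forall>i\<in>I. (\<Sum>j<m-1. b i j * y j) = 0 \<Longrightarrow> \<forall>j<m-1. y j = 0"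
  shows "I \<in> chart_sets N m b"
proof -
  have "finite I" using I(1) finite_subset by blast
  from injective_system_surjective[OF this I(2), of b "\<lambda>i. - b i (m-1)"] inj
  obtain x where "x \<in> kspace (m-1)" "\<forall>i\<in>I. (\<Sum>j<m-1. b i j * x j) = - b i (m-1)" by blast
  then have x: "x \<in> kspace (m-1)" "\<forall>i\<in>I. aff_form m b i x = 0" by (auto simp: aff_form_def)
  have "y = x" if y: "y \<in> kspace (m-1)" "\<forall>i\<in>I. aff_form m b i y = 0" for y
  proof -
    have "(\<Sum>j<m-1. b i j * (y j - x j)) = aff_form m b i y - aff_form m b i x" for i
      by (simp add: aff_form_def right_diff_distrib sum_subtractf)
    then have "\<forall>j<m-1. y j - x j = 0" using x y inj[of "\<lambda>j. y j - x j"] by simp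
    then have "y l = x l" for l using x(1) y(1) by (cases "l < m - 1") (simp_all add: kspace_def)
    then show "y = x" by blast
  qed
  with x have "\<exists>!x. x \<in> kspace (m-1) \<and> (\<forall>i\<in>I. aff_form m b i x = 0)" by (intro ex1I[of _ x]) blast+
  then show ?thesis using I by (simp add: chart_sets_def)
qed

text \<open>Evaluation at the origin gives the constant term, evaluation at unit vectors the rest.
  This makes the choice in \<open>chart_coeffs\<close> unambiguous on the relevant entries.\<close>

lemma aff_form_eq_imp_coeff_eq:
  fixes c c' :: "nat \<Rightarrow> nat \<Rightarrow> 'k::field"
  assumes eq: "\<And>y. y \<in> kspace (m-1) \<Longrightarrow> aff_form m c i y = aff_form m c' i y" and j: "j < m"
  shows "c i j = c' i j"
proof -
  have const: "c i (m-1) = c' i (m-1)" using eq[of "\<lambda>_. 0"] by (simp add: aff_form_def kspace_def)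
  show ?thesis
  proof (cases "j = m - 1")
    case False
    then have "j < m - 1" using j by simp
    then have unit: "(\<Sum>l<m-1. e i l * (if l = j then 1 else 0)) = e i j" for e :: "nat \<Rightarrow> nat \<Rightarrow> 'k"
      by (simp add: if_distrib[of "\<lambda>t. _ * t"] cong: if_cong)
    have "c i j + c i (m-1) = c' i j + c' i (m-1)"
      using eq[of "\<lambda>l. if l = j then 1 else 0"] \<open>j < m - 1\<close> unfolding aff_form_def unit by (auto simp: kspace_def)
    then show ?thesis using const by simp
  qed (use const in simp)
qed

context
  fixes N m :: nat and b :: "nat \<Rightarrow> nat \<Rightarrow> 'k::field" and I :: "nat set"
  assumes I: "I \<in> chart_sets N m b"
begin

lemma chart_set_finite: "finite I" "card I = m - 1" "I \<subseteq> {..<N}"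
  using I finite_subset[of I "{..<N}"] by (auto simp: chart_sets_def)

text \<open>Adding a kernel vector to the unique common zero gives another common zero.\<close>

lemma chart_set_injective:
  assumes y: "\<forall>i\<in>I. (\<Sum>j<m-1. b i j * y j) = 0"
  shows "\<forall>j<m-1. y j = 0"
proof -
  from I obtain x where
    x: "x \<in> kspace (m-1)" "\<forall>i\<in>I. aff_form m b i x = 0" and
    unique: "\<And>x'. x' \<in> kspace (m-1) \<Longrightarrow> \<forall>i\<in>I. aff_form m b i x' = 0 \<Longrightarrow> x' = x"
    unfolding chart_sets_def by blast
  define x' where "x' = (\<lambda>j. if j < m - 1 then x j + y j else 0)"
  have "aff_form m b i x' = aff_form m b i x + (\<Sum>j<m-1. b i j * y j)" for i
    by (simp add: aff_form_def x'_def algebra_simps sum.distrib)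
  then have "x' = x" using x y by (intro unique) (simp_all add: kspace_def x'_def)
  then show ?thesis by (metis add_cancel_left_right x'_def)
qed

lemma chart_system_solvable: "\<exists>x\<in>kspace (m-1). \<forall>i\<in>I. (\<Sum>j<m-1. b i j * x j) = z i"
  by (rule injective_system_surjective[OF chart_set_finite(1,2)]) (rule chart_set_injective)

lemma chart_index_bij: "bij_betw ((!) (sorted_list_of_set I)) {..<m-1} I"
  using bij_betw_nth[of "sorted_list_of_set I"] chart_set_finite by simp

lemma sum_chart_index: "(\<Sum>j<m-1. h (sorted_list_of_set I ! j)) = sum h I"
  by (rule sum.reindex_bij_betw[OF chart_index_bij])

lemma chart_coords_surjective:
  assumes y: "y \<in> kspace (m-1)"
  shows "\<exists>x\<in>kspace (m-1). chart_coords m b I x = y"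
proof -
  \<comment> \<open>The inverse of the increasing enumeration of \<open>I\<close>: right-hand sides
    are indexed by elements of \<open>I\<close>, coordinates by their positions.\<close>
  define pos where "pos = the_inv_into {..<m-1} ((!) (sorted_list_of_set I))"
  have pos: "pos (sorted_list_of_set I ! j) = j" if "j < m - 1" for j
    unfolding pos_def by (rule the_inv_into_f_f) (use that chart_index_bij in \<open>auto simp: bij_betw_def\<close>)
  have mem: "sorted_list_of_set I ! j \<in> I" if "j < m - 1" for j
    using chart_index_bij that by (auto simp: bij_betw_def)
  obtain x where x: "x \<in> kspace (m-1)"
    "\<forall>i\<in>I. (\<Sum>j<m-1. b i j * x j) = y (pos i) - b i (m-1)"
    using chart_system_solvable[of "\<lambda>i. y (pos i) - b i (m-1)"] by blast
  have "chart_coords m b I x j = y j" for j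
    using x(2) mem[of j] pos[of j] y by (auto simp: chart_coords_def aff_form_def kspace_def)
  with x(1) show ?thesis by blast
qed

text \<open>Justifies the choice in \<open>chart_coeffs\<close>. With \<open>\<xi>\<close> the
  common zero and \<open>\<eta> s\<close> the basis dual to the linear parts, each point is
  \<open>\<xi>\<close> plus the sum of the \<open>\<eta> s\<close> weighted by the values of the
  forms in \<open>I\<close>; applying form \<open>i\<close> reads off the coefficients.\<close>

lemma chart_coeffs_exist:
  "\<exists>c. \<forall>i<N. \<forall>x \<in> kspace (m-1). aff_form m c i (chart_coords m b I x) = aff_form m b i x"
proof -
  have "\<forall>s\<in>I. \<exists>x\<in>kspace (m-1). \<forall>i\<in>I. (\<Sum>l<m-1. b i l * x l) = (if i = s then 1 else 0)"
    by (intro ballI chart_system_solvable)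
  then obtain \<eta> where \<eta>: "\<And>s i. s \<in> I \<Longrightarrow> i \<in> I \<Longrightarrow> (\<Sum>l<m-1. b i l * \<eta> s l) = (if i = s then 1 else 0)"
    by metis
  obtain \<xi> where \<xi>: "\<And>i. i \<in> I \<Longrightarrow> (\<Sum>l<m-1. b i l * \<xi> l) = - b i (m-1)"
    using chart_system_solvable[of "\<lambda>i. - b i (m-1)"] by blast
  let ?L = "\<lambda>j. sorted_list_of_set I ! j"
  define c where "c = (\<lambda>i j. if j = m - 1 then aff_form m b i \<xi> else (\<Sum>l<m-1. b i l * \<eta> (?L j) l))"
  have expand: "(\<Sum>l<m-1. b i l * (\<xi> l + (\<Sum>s\<in>I. aff_form m b s x * \<eta> s l))) =
    (\<Sum>l<m-1. b i l * \<xi> l) + (\<Sum>s\<in>I. aff_form m b s x * (\<Sum>l<m-1. b i l * \<eta> s l))" for i x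
    unfolding distrib_left sum.distrib sum_distrib_left
    by (subst sum.swap) (simp add: ac_simps)
  \<comment> \<open>The linear parts of the forms in \<open>I\<close> agree on the point and its
    expansion, so injectivity identifies them.\<close>
  have x_eq: "\<forall>l<m-1. x l - (\<xi> l + (\<Sum>s\<in>I. aff_form m b s x * \<eta> s l)) = 0" for x
  proof (rule chart_set_injective, rule ballI)
    fix i assume i: "i \<in> I"
    have "(\<Sum>s\<in>I. aff_form m b s x * (\<Sum>l<m-1. b i l * \<eta> s l)) = (\<Sum>s\<in>I. if i = s then aff_form m b s x else 0)"
      by (rule sum.cong) (simp_all add: \<eta> i del: One_nat_def)
    also have "\<dots> = aff_form m b i x" using i chart_set_finite(1) by simp
    finally show "(\<Sum>l<m-1. b i l * (x l - (\<xi> l + (\<Sum>s\<in>I. aff_form m b s x * \<eta> s l)))) = 0"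
      unfolding right_diff_distrib sum_subtractf expand \<xi>[OF i] by (simp add: aff_form_def)
  qed
  have "aff_form m c i (chart_coords m b I x) = aff_form m b i x" for i x
  proof -
    have "aff_form m b i x = (\<Sum>l<m-1. b i l * (\<xi> l + (\<Sum>s\<in>I. aff_form m b s x * \<eta> s l))) + b i (m-1)"
      using x_eq[of x] by (simp add: aff_form_def)
    also have "\<dots> = (\<Sum>s\<in>I. aff_form m b s x * (\<Sum>l<m-1. b i l * \<eta> s l)) + aff_form m b i \<xi>"
      unfolding expand by (simp add: aff_form_def)
    also have "\<dots> = aff_form m c i (chart_coords m b I x)"
      unfolding sum_chart_index[symmetric] by (simp add: aff_form_def c_def chart_coords_def ac_simps)
    finally show ?thesis by simp
  qed
  then show ?thesis by blast
qed

lemma aff_form_chart_coeffs: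
  assumes "i < N" and "x \<in> kspace (m-1)"
  shows "aff_form m (chart_coeffs N m b I) i (chart_coords m b I x) = aff_form m b i x"
  using someI_ex[OF chart_coeffs_exist] assms unfolding chart_coeffs_def by blast

text \<open>Expanding the linear part of form \<open>i\<close> in those of the chart rewrites the
  whole form, up to a constant \<open>k0\<close>; uniqueness of coefficients identifies the result
  with the chosen ones.\<close>

lemma chart_coeffs_eqI:
  assumes i: "i < N" and j: "j < m - 1"
    and E: "\<And>l. l < m - 1 \<Longrightarrow> b i l = (\<Sum>s\<in>I. E s * b s l)"
  shows "chart_coeffs N m b I i j = E (sorted_list_of_set I ! j)"
proof -
  let ?L = "\<lambda>j. sorted_list_of_set I ! j"
  define k0 where "k0 = b i (m-1) - (\<Sum>s\<in>I. E s * b s (m-1))"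
  define c :: "nat \<Rightarrow> nat \<Rightarrow> 'k" where "c = (\<lambda>i' j. if j = m - 1 then k0 else E (?L j))"
  have "aff_form m c i (chart_coords m b I x) = aff_form m b i x" for x
  proof -
    have "(\<Sum>l<m-1. b i l * x l) = (\<Sum>l<m-1. (\<Sum>s\<in>I. E s * b s l) * x l)" by (simp add: E)
    also have "\<dots> = (\<Sum>s\<in>I. E s * (\<Sum>l<m-1. b s l * x l))"
      unfolding sum_distrib_left sum_distrib_right by (subst sum.swap) (simp add: ac_simps)
    finally have *: "(\<Sum>l<m-1. b i l * x l) = (\<Sum>s\<in>I. E s * (\<Sum>l<m-1. b s l * x l))" .
    have "aff_form m c i (chart_coords m b I x) =
      (\<Sum>s\<in>I. E s * aff_form m b s x) + k0"
      unfolding sum_chart_index[symmetric] aff_form_def[of m c] by (simp add: c_def chart_coords_def)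
    also have "\<dots> = aff_form m b i x"
      unfolding aff_form_def * k0_def by (simp add: distrib_left sum.distrib)
    finally show ?thesis .
  qed
  then have "aff_form m (chart_coeffs N m b I) i y = aff_form m c i y" if "y \<in> kspace (m-1)" for y
    using chart_coords_surjective[OF that] aff_form_chart_coeffs[OF i] by metis
  from aff_form_eq_imp_coeff_eq[OF this, of j] show ?thesis using j by (simp add: c_def)
qed

end

section \<open>Valuations\<close>

context
  fixes v :: "'k::field \<Rightarrow> ereal"
  assumes v: "nonarch_valuation v"
begin

lemma val_not_MInf: "v x \<noteq> -\<infinity>"
  and val_eq_PInf: "v x = \<infinity> \<longleftrightarrow> x = 0"
  and val_mult: "v (x * y) = v x + v y"
  and val_add: "min (v x) (v y) \<le> v (x + y)"
  using v unfolding nonarch_valuation_def by blast+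

lemma val_zero: "v 0 = \<infinity>"
  by (simp add: val_eq_PInf)

text \<open>Allows real arithmetic with valuations. At zero it is the default value 0 of
  \<open>real_of_ereal\<close>, which is why \<open>ereal_val\<close> asks for a nonzero
  argument.\<close>

definition val :: "'k \<Rightarrow> real" where "val x = real_of_ereal (v x)"

lemma ereal_val: "x \<noteq> 0 \<Longrightarrow> ereal (val x) = v x"
  using val_not_MInf[of x] val_eq_PInf[of x] by (cases "v x") (auto simp: val_def)

lemma val_one: "v 1 = 0"
  using val_mult[of 1 1] ereal_val[of 1, symmetric] by (simp add: zero_ereal_def)

lemma val_minus: "v (- x) = v x"
proof -
  have "v (-1) + v (-1) = 0" using val_mult[of "-1" "-1"] val_one by simp
  then have "v (-1) = 0" using ereal_val[of "-1", symmetric] by (simp add: zero_ereal_def)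
  then show ?thesis using val_mult[of "-1" x] by simp
qed

lemma val_diff: "min (v x) (v y) \<le> v (x - y)"
  using val_add[of x "- y"] by (simp add: val_minus)

text \<open>Each summand is the difference of the sum and the other summand, so a sum of too large a
  valuation would force the two valuations to coincide.\<close>

lemma val_add_eq_min:
  assumes "v x \<noteq> v y"
  shows "v (x + y) = min (v x) (v y)"
  using val_add[of x y] val_diff[of "x + y" y] val_diff[of "x + y" x] assms
  by (auto simp: min_def split: if_splits)

lemma val_sum_ge:
  assumes "finite J" and "\<And>j. j \<in> J \<Longrightarrow> c \<le> v (f j)"
  shows "c \<le> v (sum f J)"
  using assms
proof (induction J rule: finite_induct)
  case (insert j J)
  then have "c \<le> min (v (f j)) (v (sum f J))" by simp
  also have "\<dots> \<le> v (f j + sum f J)" by (rule val_add)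
  finally show ?case using insert by simp
qed (simp add: val_zero)

text \<open>The valuation of a partial sum is attained by one of its terms, hence differs from that
  of the next term, and nothing cancels.\<close>

lemma val_sum_distinct:
  assumes "finite J" and "J \<noteq> {}" and "inj_on (\<lambda>j. v (f j)) J"
  shows "v (sum f J) = Min ((\<lambda>j. v (f j)) ` J)"
  using assms
proof (induction J rule: finite_ne_induct)
  case (insert j J)
  then have IH: "v (sum f J) = Min ((\<lambda>j. v (f j)) ` J)" by simp
  have "Min ((\<lambda>j. v (f j)) ` J) \<in> (\<lambda>j. v (f j)) ` J" using insert.hyps by (intro Min_in) auto
  then have "v (f j) \<noteq> v (sum f J)" using insert IH by (auto simp del: Min_in)
  from val_add_eq_min[OF this] show ?case using insert IH by simp
qed simp

lemma val_divide_nonneg: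
  assumes "v y \<le> v x" and "y \<noteq> 0"
  shows "0 \<le> v (x / y)"
proof -
  have "v x = v (x / y) + v y" using val_mult[of "x / y" y] assms(2) by simp
  then show ?thesis using assms ereal_val[of y, symmetric]
    by (cases "v (x / y)") (auto simp: zero_ereal_def)
qed

text \<open>Here \<open>e\<close> is an integral coefficient and \<open>e * x / y\<close> the chart
  coefficient after undoing the rescaling; the result is the inequality that
  \<open>trop_form_eq_val\<close> asks for.\<close>

lemma val_divide_mult:
  assumes "y \<noteq> 0" "0 \<le> v e"
  shows "v x \<le> v (e * x / y) + v y"
proof -
  have "v (e * x / y) + v y = v e + v x"
    using assms val_mult[of "e * x / y" y] val_mult[of e x] by simp
  then show ?thesis using assms(2) by (simp add: add_increasing)
qed

text \<open>
  A finitely generated torsion-free module over the valuation ring is free, with a basis among any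
  given generators: in a nontrivial relation, divide by a coefficient of least valuation.
\<close>

lemma integral_basis:
  fixes g :: "'i \<Rightarrow> 'j \<Rightarrow> 'k"
  assumes P: "finite P"
  obtains S where "S \<subseteq> P"
    and "\<And>i. i \<in> P \<Longrightarrow> \<exists>e. (\<forall>s\<in>S. 0 \<le> v (e s)) \<and> (\<forall>j\<in>J. g i j = (\<Sum>s\<in>S. e s * g s j))"
    and "\<And>e. \<forall>j\<in>J. (\<Sum>s\<in>S. e s * g s j) = 0 \<Longrightarrow> \<forall>s\<in>S. e s = 0"
proof -
  define comb where "comb = (\<lambda>S i. \<exists>e. (\<forall>s\<in>S. 0 \<le> v (e s)) \<and> (\<forall>j\<in>J. g i j = (\<Sum>s\<in>S. e s * g s j)))"
  define gen where "gen = (\<lambda>S. S \<subseteq> P \<and> (\<forall>i\<in>P. comb S i))"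
  have "gen P" unfolding gen_def
  proof (intro conjI ballI subset_refl)
    fix i assume i: "i \<in> P"
    have "g i j = (\<Sum>s\<in>P. (if s = i then 1 else 0) * g s j)" for j
      using P i by (simp add: if_distrib[of "\<lambda>t. t * _"] cong: if_cong)
    then show "comb P i"
      unfolding comb_def by (intro exI[of _ "\<lambda>s. if s = i then 1 else 0"]) (simp add: val_one val_zero)
  qed
  \<comment> \<open>A generating subset of least cardinality: any nontrivial relation would allow a
    generator to be dropped.\<close>
  then obtain S where S: "gen S" and least: "\<And>S'. gen S' \<Longrightarrow> card S \<le> card S'"
    using ex_has_least_nat[of gen P card] by blast
  have fin: "finite S" using S P unfolding gen_def by (blast intro: finite_subset)
  have "\<forall>s\<in>S. e s = 0" if rel: "\<forall>j\<in>J. (\<Sum>s\<in>S. e s * g s j) = 0" for e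
  proof (rule ccontr)
    assume "\<not> (\<forall>s\<in>S. e s = 0)"
    then obtain s0 where s0: "s0 \<in> S" "e s0 \<noteq> 0" by blast
    obtain t where t: "t \<in> S" "\<And>s. s \<in> S \<Longrightarrow> v (e t) \<le> v (e s)"
      using arg_min_if_finite[OF fin, of "\<lambda>s. v (e s)"] s0 by (metis empty_iff not_less)
    have et: "e t \<noteq> 0" using t(2)[OF s0(1)] s0(2) by (auto simp: val_zero val_eq_PInf)
    have rel_t: "g t j = (\<Sum>s\<in>S - {t}. - (e s / e t) * g s j)" if "j \<in> J" for j
    proof -
      have "e t * g t j + (\<Sum>s\<in>S - {t}. e s * g s j) = 0"
        using rel that t(1) fin by (simp add: sum.remove[of S t])
      then have "e t * g t j = e t * (\<Sum>s\<in>S - {t}. - (e s / e t) * g s j)"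
        using et by (simp add: sum_distrib_left sum_negf eq_neg_iff_add_eq_0)
      then show ?thesis using et by simp
    qed
    have "gen (S - {t})" unfolding gen_def
    proof (intro conjI ballI)
      show "S - {t} \<subseteq> P" using S by (auto simp: gen_def)
      fix i assume "i \<in> P"
      then have "comb S i" using S by (simp add: gen_def)
      then obtain c where c: "\<And>s. s \<in> S \<Longrightarrow> 0 \<le> v (c s)" "\<And>j. j \<in> J \<Longrightarrow> g i j = (\<Sum>s\<in>S. c s * g s j)"
        unfolding comb_def by auto
      \<comment> \<open>Generator \<open>t\<close> is replaced by its expression
        \<open>rel_t\<close>; the quotients \<open>e s / e t\<close> are integral by the choice of
        \<open>t\<close>.\<close>
      define c' where "c' = (\<lambda>s. c s - c t * (e s / e t))"
      have "0 \<le> v (c' s)" if "s \<in> S - {t}" for s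
      proof -
        have "0 \<le> v (c t * (e s / e t))"
          unfolding val_mult[of "c t"] using c(1)[OF t(1)] val_divide_nonneg[OF t(2) et, of s] that by simp
        with c(1)[of s] that have "0 \<le> min (v (c s)) (v (c t * (e s / e t)))" by simp
        then show ?thesis unfolding c'_def using val_diff by (rule order_trans)
      qed
      moreover have "g i j = (\<Sum>s\<in>S - {t}. c' s * g s j)" if "j \<in> J" for j
      proof -
        have "g i j = c t * g t j + (\<Sum>s\<in>S - {t}. c s * g s j)"
          using c(2)[OF that] t(1) fin by (simp add: sum.remove[of S t])
        also have "\<dots> = (\<Sum>s\<in>S - {t}. c' s * g s j)"
          unfolding rel_t[OF that] c'_def
          by (simp add: sum_distrib_left algebra_simps sum_subtractf sum_negf)
        finally show ?thesis .
      qed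
      ultimately show "comb (S - {t}) i"
        unfolding comb_def by (intro exI[of _ c']) simp
    qed
    from least[OF this] show False using card_Diff1_less[OF fin t(1)] by simp
  qed
  moreover have "S \<subseteq> P" "\<And>i. i \<in> P \<Longrightarrow> comb S i" using S by (simp_all add: gen_def)
  ultimately show thesis using that[of S] by (simp add: comb_def)
qed

lemma val_aff_form_ge:
  assumes "\<And>j. j < m - 1 \<Longrightarrow> c \<le> v (b i j * x j)" and "c \<le> v (b i (m-1))"
  shows "c \<le> v (aff_form m b i x)"
proof -
  have "c \<le> v (\<Sum>j<m-1. b i j * x j)" using assms(1) by (intro val_sum_ge) auto
  then show ?thesis unfolding aff_form_def using assms(2) val_add order_trans min.boundedI by metis
qed

text \<open>The constant term is the value of the form minus the other monomials, so its valuation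
  obeys the same lower bound as theirs. No term of the minimum then lies below the value, and the
  ultrametric inequality gives the converse.\<close>

lemma trop_form_eq_val:
  assumes lin: "\<And>j. j < m - 1 \<Longrightarrow> x j \<noteq> 0 \<and> r j = val (x j)"
    and ge: "\<And>j. j < m - 1 \<Longrightarrow> v (aff_form m c i x) \<le> v (c i j) + v (x j)"
  shows "trop_form v m c i r = v (aff_form m c i x)"
proof -
  have r: "v (x j) = ereal (r j)" if "j < m - 1" for j using ereal_val lin[OF that] by simp
  have const: "c i (m-1) = aff_form m c i x - (\<Sum>j<m-1. c i j * x j)" by (simp add: aff_form_def)
  have "v (aff_form m c i x) \<le> v (\<Sum>j<m-1. c i j * x j)"
    using ge by (intro val_sum_ge) (simp_all add: val_mult)
  then have "v (aff_form m c i x) \<le> v (c i (m-1))"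
    unfolding const using val_diff order_trans min.boundedI by (metis order_refl)
  then have "v (aff_form m c i x) \<le> trop_form v m c i r"
    unfolding trop_form_def using ge by (auto simp: r)
  moreover have "trop_form v m c i r \<le> v (aff_form m c i x)"
    by (rule val_aff_form_ge) (auto simp: trop_form_def val_mult r intro!: Min_le)
  ultimately show ?thesis by simp
qed

end

section \<open>Projections of polyhedra\<close>

lemma ex_real_between_finite:
  fixes l u :: "'a \<Rightarrow> real"
  assumes "finite L" "finite U" "\<And>a b. a \<in> L \<Longrightarrow> b \<in> U \<Longrightarrow> l a \<le> u b"
  shows "\<exists>t. (\<forall>a\<in>L. l a \<le> t) \<and> (\<forall>b\<in>U. t \<le> u b)"
proof (cases "L = {}")
  case True
  show ?thesis
  proof (cases "U = {}")
    case False
    with True assms(2) show ?thesis by (intro exI[of _ "Min (u ` U)"]) auto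
  qed (use True in auto)
next
  case False
  with assms show ?thesis by (intro exI[of _ "Max (l ` L)"]) auto
qed

text \<open>Positive coefficients bound \<open>t\<close> from above, negative ones from below; a
  solution exists iff no lower bound exceeds an upper one. Cross-multiplied, these comparisons are
  again affine in the remaining data.\<close>

lemma eliminate_real_variable:
  fixes A \<alpha> :: "'a \<Rightarrow> real"
  assumes "finite H"
  shows "(\<exists>t. \<forall>h\<in>H. A h + \<alpha> h * t \<le> 0) \<longleftrightarrow>
    (\<forall>h\<in>H. \<alpha> h = 0 \<longrightarrow> A h \<le> 0) \<and>
    (\<forall>h\<in>H. \<forall>h'\<in>H. 0 < \<alpha> h \<longrightarrow> \<alpha> h' < 0 \<longrightarrow> \<alpha> h * A h' - \<alpha> h' * A h \<le> 0)"
    (is "?lhs \<longleftrightarrow> ?rhs")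
proof
  assume ?lhs
  then obtain t where t: "\<And>h. h \<in> H \<Longrightarrow> A h + \<alpha> h * t \<le> 0" by blast
  show ?rhs
  proof (intro conjI ballI impI)
    fix h h' assume h: "h \<in> H" "h' \<in> H" "0 < \<alpha> h" "\<alpha> h' < 0"
    have "\<alpha> h * (A h' + \<alpha> h' * t) \<le> 0" "- \<alpha> h' * (A h + \<alpha> h * t) \<le> 0"
      using t[OF h(1)] t[OF h(2)] h(3,4) by (auto intro!: mult_nonneg_nonpos mult_nonpos_nonpos)
    then show "\<alpha> h * A h' - \<alpha> h' * A h \<le> 0" by (simp add: algebra_simps)
  qed (use t in force)
next
  assume rhs: ?rhs
  have "\<exists>t. (\<forall>h\<in>{h \<in> H. \<alpha> h < 0}. - A h / \<alpha> h \<le> t) \<and> (\<forall>h\<in>{h \<in> H. 0 < \<alpha> h}. t \<le> - A h / \<alpha> h)"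
  proof (rule ex_real_between_finite)
    fix h' h assume "h' \<in> {h \<in> H. \<alpha> h < 0}" "h \<in> {h \<in> H. 0 < \<alpha> h}"
    moreover from this have "\<alpha> h * A h' - \<alpha> h' * A h \<le> 0" using rhs by blast
    ultimately show "- A h' / \<alpha> h' \<le> - A h / \<alpha> h" by (simp add: divide_simps algebra_simps)
  qed (use assms in auto)
  then obtain t where t: "\<And>h. h \<in> H \<Longrightarrow> \<alpha> h < 0 \<Longrightarrow> - A h / \<alpha> h \<le> t"
    "\<And>h. h \<in> H \<Longrightarrow> 0 < \<alpha> h \<Longrightarrow> t \<le> - A h / \<alpha> h" by blast
  have "A h + \<alpha> h * t \<le> 0" if "h \<in> H" for h
  proof (cases "\<alpha> h" "0 :: real" rule: linorder_cases)
    case less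
    then show ?thesis using t(1)[OF that] by (simp add: divide_simps algebra_simps split: if_splits)
  next
    case equal
    then show ?thesis using rhs that by simp
  next
    case greater
    then show ?thesis using t(2)[OF that] by (simp add: divide_simps algebra_simps split: if_splits)
  qed
  then show ?lhs by blast
qed

text \<open>Fourier--Motzkin elimination, one variable at a time.\<close>

lemma closed_projection_pairs:
  fixes H :: "(('a::topological_space \<Rightarrow> real) \<times> (nat \<Rightarrow> real)) set"
  assumes "finite H" and "\<And>h. h \<in> H \<Longrightarrow> continuous_on UNIV (fst h)"
  shows "closed {y. \<exists>r. \<forall>h\<in>H. fst h y + (\<Sum>j<d. snd h j * r j) \<le> 0}"
  using assms
proof (induction d arbitrary: H)
  case 0
  have "{y. \<exists>r::nat \<Rightarrow> real. \<forall>h\<in>H. fst h y + (\<Sum>j<0. snd h j * r j) \<le> 0} = (\<Inter>h\<in>H. {y. fst h y \<le> 0})"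
    by auto
  also have "closed \<dots>" using 0 by (intro closed_INT ballI closed_Collect_le) auto
  finally show ?case .
next
  case (Suc d)
  \<comment> \<open>Combines an upper bound \<open>h\<close> and a lower bound \<open>h'\<close> on
    the last variable so that it cancels. In each pair \<open>fst\<close> holds the dependence on
    \<open>y\<close> and \<open>snd\<close> the coefficients of the variables.\<close>
  define elim :: "('a \<Rightarrow> real) \<times> (nat \<Rightarrow> real) \<Rightarrow> ('a \<Rightarrow> real) \<times> (nat \<Rightarrow> real) \<Rightarrow> ('a \<Rightarrow> real) \<times> (nat \<Rightarrow> real)"
    where "elim = (\<lambda>h h'. (\<lambda>y. snd h d * fst h' y - snd h' d * fst h y,
                           \<lambda>j. snd h d * snd h' j - snd h' d * snd h j))"
  define Z where "Z = {h \<in> H. snd h d = 0}"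
  define E where "E = (\<Union>h\<in>{h \<in> H. 0 < snd h d}. elim h ` {h' \<in> H. snd h' d < 0})"
  define A where "A = (\<lambda>(y :: 'a) r h. fst h y + (\<Sum>j<d. snd h j * r j :: real))"
  have A_elim: "A y r (elim h h') = snd h d * A y r h' - snd h' d * A y r h" for y r h h'
    by (simp add: A_def elim_def sum_subtractf algebra_simps sum_distrib_left)
  have "(\<exists>r. \<forall>h\<in>H. fst h y + (\<Sum>j<Suc d. snd h j * r j) \<le> 0) \<longleftrightarrow> (\<exists>r. \<forall>h\<in>Z \<union> E. A y r h \<le> 0)" for y
  proof -
    have "(\<exists>r. \<forall>h\<in>H. fst h y + (\<Sum>j<Suc d. snd h j * r j) \<le> 0) \<longleftrightarrow>
      (\<exists>r t. \<forall>h\<in>H. A y r h + snd h d * t \<le> 0)"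
    proof
      assume "\<exists>r t. \<forall>h\<in>H. A y r h + snd h d * t \<le> 0"
      then obtain r t where "\<forall>h\<in>H. A y r h + snd h d * t \<le> 0" by blast
      \<comment> \<open>The sum in \<open>A\<close> stops before index \<open>d\<close>, so entry
        \<open>d\<close> of \<open>r\<close> is free to store \<open>t\<close>.\<close>
      then show "\<exists>r. \<forall>h\<in>H. fst h y + (\<Sum>j<Suc d. snd h j * r j) \<le> 0"
        by (intro exI[of _ "r(d := t)"]) (simp add: A_def add.assoc)
    qed (auto simp: A_def add.assoc)
    also have "\<dots> \<longleftrightarrow> (\<exists>r. \<forall>h\<in>Z \<union> E. A y r h \<le> 0)"
      unfolding eliminate_real_variable[OF Suc.prems(1)]
      unfolding Z_def E_def ball_Un UN_ball_bex_simps ball_simps A_elim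
      by (intro ex_cong1) blast
    finally show ?thesis .
  qed
  then have "{y. \<exists>r. \<forall>h\<in>H. fst h y + (\<Sum>j<Suc d. snd h j * r j) \<le> 0} = {y. \<exists>r. \<forall>h\<in>Z \<union> E. A y r h \<le> 0}"
    by simp
  also have "closed \<dots>" unfolding A_def
  proof (rule Suc.IH)
    show "finite (Z \<union> E)" unfolding Z_def E_def
      using Suc.prems(1) by auto
    have "continuous_on UNIV (fst (elim h h'))" if "h \<in> H" "h' \<in> H" for h h'
      unfolding elim_def fst_conv by (intro continuous_intros Suc.prems(2) that)
    then show "continuous_on UNIV (fst h)" if "h \<in> Z \<union> E" for h
      using that Suc.prems(2) unfolding Z_def E_def by blast
  qed
  finally show ?case .
qed

text \<open>The constraints suited to elimination: affine in the variables \<open>r\<close> to be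
  projected away, but merely continuous in the parameter \<open>y\<close>, so that closedness can be
  stated in the space of all real sequences.\<close>

definition partially_affine :: "nat \<Rightarrow> ('a::topological_space \<Rightarrow> (nat \<Rightarrow> real) \<Rightarrow> real) \<Rightarrow> bool" where
  "partially_affine d h \<longleftrightarrow>
     (\<exists>g \<alpha>. continuous_on UNIV g \<and> (\<forall>y r. h y r = g y + (\<Sum>j<d. \<alpha> j * r j)))"

lemma partially_affine_fst:
  "continuous_on UNIV g \<Longrightarrow> partially_affine d (\<lambda>y r. g y)"
  unfolding partially_affine_def by (intro exI[of _ g] exI[of _ "\<lambda>_. 0"]) simp

lemma partially_affine_snd:
  "partially_affine d (\<lambda>y r. if j < d then r j else 0)"
  unfolding partially_affine_def
  by (intro exI[of _ "\<lambda>_. 0"] exI[of _ "\<lambda>i. if i = j then 1 else 0"])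
    (auto simp: if_distrib[of "\<lambda>t. t * _"] cong: if_cong)

lemma partially_affine_add:
  assumes "partially_affine d h" "partially_affine d h'"
  shows "partially_affine d (\<lambda>y r. h y r + h' y r)"
proof -
  from assms obtain g \<alpha> g' \<alpha>' where
    "continuous_on UNIV g" "\<And>y r. h y r = g y + (\<Sum>j<d. \<alpha> j * r j)"
    "continuous_on UNIV g'" "\<And>y r. h' y r = g' y + (\<Sum>j<d. \<alpha>' j * r j)"
    unfolding partially_affine_def by blast
  then show ?thesis unfolding partially_affine_def
    by (intro exI[of _ "\<lambda>y. g y + g' y"] exI[of _ "\<lambda>j. \<alpha> j + \<alpha>' j"])
      (auto simp: distrib_right sum.distrib intro!: continuous_intros)
qed

lemma partially_affine_cmult:
  assumes "partially_affine d h"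
  shows "partially_affine d (\<lambda>y r. c * h y r)"
proof -
  from assms obtain g \<alpha> where
    "continuous_on UNIV g" "\<And>y r. h y r = g y + (\<Sum>j<d. \<alpha> j * r j)"
    unfolding partially_affine_def by blast
  then show ?thesis unfolding partially_affine_def
    by (intro exI[of _ "\<lambda>y. c * g y"] exI[of _ "\<lambda>j. c * \<alpha> j"])
      (auto simp: distrib_left sum_distrib_left mult.assoc intro!: continuous_intros)
qed

lemma partially_affine_diff:
  assumes "partially_affine d h" "partially_affine d h'"
  shows "partially_affine d (\<lambda>y r. h y r - h' y r)"
  using partially_affine_add[OF assms(1) partially_affine_cmult[OF assms(2), of "-1"]] by simp

lemma partially_affine_sum:
  assumes "\<And>i. i \<in> S \<Longrightarrow> partially_affine d (h i)"
  shows "partially_affine d (\<lambda>y r. \<Sum>i\<in>S. h i y r)"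
  using assms
proof (induction S rule: infinite_finite_induct)
  case (insert i S)
  then show ?case by (simp add: partially_affine_add)
qed (simp_all add: partially_affine_fst)

lemma closed_projection:
  assumes "finite H" and aff: "\<And>h. h \<in> H \<Longrightarrow> partially_affine d h"
  shows "closed {y. \<exists>r. \<forall>h\<in>H. h y r \<le> 0}"
proof -
  have "\<forall>h\<in>H. \<exists>p. continuous_on UNIV (fst p) \<and> (\<forall>y r. h y r = fst p y + (\<Sum>j<d. snd p j * r j))"
    using aff unfolding partially_affine_def by (metis fst_conv snd_conv)
  then obtain p where p: "\<And>h. h \<in> H \<Longrightarrow> continuous_on UNIV (fst (p h))"
    "\<And>h y r. h \<in> H \<Longrightarrow> h y r = fst (p h) y + (\<Sum>j<d. snd (p h) j * r j)" by metis
  have "{y. \<exists>r. \<forall>h\<in>H. h y r \<le> 0} = {y. \<exists>r. \<forall>q\<in>p ` H. fst q y + (\<Sum>j<d. snd q j * r j) \<le> 0}"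
    using p(2) by simp
  also have "closed \<dots>" using assms(1) p(1) by (intro closed_projection_pairs) auto
  finally show ?thesis .
qed

lemma closed_vanishing_tail: "closed {y :: nat \<Rightarrow> real. \<forall>l\<ge>m. y l = 0}"
proof -
  have "{y :: nat \<Rightarrow> real. \<forall>l\<ge>m. y l = 0} = (\<Inter>l\<in>{m..}. {y. y l = 0})" by auto
  also have "closed \<dots>"
    by (intro closed_INT ballI closed_Collect_eq continuous_on_product_coordinates continuous_on_const)
  finally show ?thesis .
qed

text \<open>Fixing an index \<open>\<sigma> i\<close> that attains each minimum makes the map affine
  on a polyhedron. The image is the union of the projections of the resulting graphs over the
  finitely many selections.\<close>

lemma closed_image_linear_of_minima:
  fixes w :: "nat \<Rightarrow> nat \<Rightarrow> real" and C :: "nat \<Rightarrow> nat \<Rightarrow> real"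
  assumes J: "\<And>i. i < N \<Longrightarrow> finite (J i) \<and> J i \<noteq> {}"
  shows "closed ((\<lambda>r l. if l < m then \<Sum>i<N. C i l * Min ((\<lambda>j. w i j + r j) ` J i) else 0) ` {r. \<forall>j\<ge>d. r j = 0})"
    (is "closed (?T ` ?R)")
proof -
  \<comment> \<open>Padding lets \<open>r\<close> range over all functions in the projection, while
    an index \<open>\<ge> d\<close>, such as that of a constant term, contributes 0.\<close>
  define pad :: "(nat \<Rightarrow> real) \<Rightarrow> nat \<Rightarrow> real" where "pad = (\<lambda>r j. if j < d then r j else 0)"
  have pad_id: "pad r = r" if "r \<in> ?R" for r using that by (auto simp: pad_def)
  have pad_in: "pad r \<in> ?R" for r by (simp add: pad_def)
  define lin where "lin = (\<lambda>\<sigma> l (r :: nat \<Rightarrow> real). \<Sum>i<N. C i l * (w i (\<sigma> i) + pad r (\<sigma> i)))"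
  \<comment> \<open>\<open>cone\<close> says that \<open>\<sigma> i\<close> attains the minimum;
    \<open>graph\<close> encodes each equation \<open>y l = lin \<sigma> l r\<close> as two opposite
    inequalities.\<close>
  define cone where "cone = (\<lambda>\<sigma>. (\<Union>i<N. (\<lambda>j (y :: nat \<Rightarrow> real) r. (w i (\<sigma> i) + pad r (\<sigma> i)) - (w i j + pad r j)) ` J i))"
  define graph where "graph = (\<lambda>\<sigma>. (\<lambda>l y r. y l - lin \<sigma> l r) ` {..<m} \<union> (\<lambda>l y r. lin \<sigma> l r - y l) ` {..<m})"
  define piece where "piece = (\<lambda>\<sigma>. {y. \<exists>r. \<forall>h\<in>cone \<sigma> \<union> graph \<sigma>. h y r \<le> 0})"
  have piece_iff: "y \<in> piece \<sigma> \<longleftrightarrow> (\<exists>r. (\<forall>i<N. \<forall>j\<in>J i. w i (\<sigma> i) + pad r (\<sigma> i) \<le> w i j + pad r j) \<and>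
      (\<forall>l<m. y l = lin \<sigma> l r))" for y \<sigma>
    unfolding piece_def cone_def graph_def by (simp add: ball_Un eq_iff) blast
  have "closed (piece \<sigma>)" for \<sigma>
    unfolding piece_def
  proof (rule closed_projection[where d = d])
    show "finite (cone \<sigma> \<union> graph \<sigma>)" using J by (auto simp: cone_def graph_def)
    have pad: "partially_affine d (\<lambda>y r. w i j + pad r j)" for i j
      unfolding pad_def by (intro partially_affine_add partially_affine_fst partially_affine_snd continuous_intros)
    have lin: "partially_affine d (\<lambda>y r. lin \<sigma> l r)" for l
      unfolding lin_def by (intro partially_affine_sum partially_affine_cmult pad)
    show "partially_affine d h" if "h \<in> cone \<sigma> \<union> graph \<sigma>" for h
      using that unfolding cone_def graph_def
      by (auto intro!: partially_affine_diff pad lin partially_affine_fst continuous_on_product_coordinates)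
  qed
  moreover have "?T ` ?R = (\<Union>\<sigma>\<in>PiE {..<N} J. piece \<sigma>) \<inter> {y. \<forall>l\<ge>m. y l = 0}"
  proof (intro equalityI subsetI)
    fix y assume "y \<in> ?T ` ?R"
    then obtain r where r: "r \<in> ?R" "y = ?T r" by blast
    have "\<exists>j\<in>J i. Min ((\<lambda>j. w i j + r j) ` J i) = w i j + r j" if "i < N" for i
      using Min_in[of "(\<lambda>j. w i j + r j) ` J i"] J[OF that] by (auto simp del: Min_in)
    then obtain \<sigma>0 where \<sigma>0: "\<And>i. i < N \<Longrightarrow> \<sigma>0 i \<in> J i \<and> Min ((\<lambda>j. w i j + r j) ` J i) = w i (\<sigma>0 i) + r (\<sigma>0 i)"
      by metis
    \<comment> \<open>Restriction places the selection in the finite set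
      \<open>PiE {..<N} J\<close>.\<close>
    define \<sigma> where "\<sigma> = restrict \<sigma>0 {..<N}"
    have \<sigma>: "\<sigma> i \<in> J i" "Min ((\<lambda>j. w i j + r j) ` J i) = w i (\<sigma> i) + r (\<sigma> i)" if "i < N" for i
      using \<sigma>0[OF that] that by (simp_all add: \<sigma>_def)
    have "y \<in> piece \<sigma>" unfolding piece_iff
    proof (intro exI[of _ r] conjI allI impI ballI)
      fix i j assume ij: "i < N" "j \<in> J i"
      then have "Min ((\<lambda>j. w i j + r j) ` J i) \<le> w i j + r j" using J by (intro Min_le) auto
      then show "w i (\<sigma> i) + pad r (\<sigma> i) \<le> w i j + pad r j" using \<sigma>(2)[OF ij(1)] pad_id[OF r(1)] by simp
    next
      fix l assume "l < m"
      then show "y l = lin \<sigma> l r" using r \<sigma>(2) pad_id[OF r(1)] by (simp add: lin_def)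
    qed
    moreover have "\<sigma> \<in> PiE {..<N} J" using \<sigma>(1) by (auto simp: \<sigma>_def)
    ultimately show "y \<in> (\<Union>\<sigma>\<in>PiE {..<N} J. piece \<sigma>) \<inter> {y. \<forall>l\<ge>m. y l = 0}" using r by auto
  next
    fix y assume "y \<in> (\<Union>\<sigma>\<in>PiE {..<N} J. piece \<sigma>) \<inter> {y. \<forall>l\<ge>m. y l = 0}"
    then obtain \<sigma> where \<sigma>: "\<sigma> \<in> PiE {..<N} J" and y0: "\<And>l. l \<ge> m \<Longrightarrow> y l = 0" and "y \<in> piece \<sigma>"
      by blast
    from \<open>y \<in> piece \<sigma>\<close> obtain r where le: "\<And>i j. i < N \<Longrightarrow> j \<in> J i \<Longrightarrow> w i (\<sigma> i) + pad r (\<sigma> i) \<le> w i j + pad r j"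
      and y: "\<And>l. l < m \<Longrightarrow> y l = lin \<sigma> l r" unfolding piece_iff by blast
    have "Min ((\<lambda>j. w i j + pad r j) ` J i) = w i (\<sigma> i) + pad r (\<sigma> i)" if "i < N" for i
      using le[OF that] J[OF that] PiE_mem[OF \<sigma>, of i] that by (intro Min_eqI) auto
    then have "y = ?T (pad r)" using y y0 by (auto simp: lin_def)
    then show "y \<in> ?T ` ?R" using pad_in by blast
  qed
  moreover have "finite (PiE {..<N} J)" using J by (intro finite_PiE) auto
  ultimately show ?thesis using closed_vanishing_tail by (auto intro!: closed_Int closed_UN)
qed

section \<open>Approximation of tropical points\<close>

lemma tendsto_funI:
  fixes f :: "'a \<Rightarrow> 'b \<Rightarrow> 'c::topological_space"
  assumes "\<And>l. ((\<lambda>n. f n l) \<longlongrightarrow> g l) F"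
  shows "(f \<longlongrightarrow> g) F"
proof -
  have "limitin (product_topology (\<lambda>_. euclidean) UNIV) f g F"
    unfolding limitin_componentwise using assms by simp
  then show ?thesis by (simp add: euclidean_product_topology)
qed

lemma tendsto_Min_image:
  fixes f :: "'a \<Rightarrow> 'b \<Rightarrow> real"
  assumes "finite J" "J \<noteq> {}" "\<And>j. j \<in> J \<Longrightarrow> ((\<lambda>n. f n j) \<longlongrightarrow> g j) F"
  shows "((\<lambda>n. Min (f n ` J)) \<longlongrightarrow> Min (g ` J)) F"
  using assms
proof (induction J rule: finite_ne_induct)
  case (insert j J)
  then show ?case by (simp add: tendsto_min)
qed simp

text \<open>An open interval minus a finite set is open and nonempty, so it meets
  \<open>G\<close>.\<close>

lemma dense_avoids_finite:
  fixes G :: "real set"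
  assumes "closure G = UNIV" "finite D" "0 < \<epsilon>"
  shows "\<exists>x\<in>G. \<bar>x - c\<bar> < \<epsilon> \<and> x \<notin> D"
proof -
  have "open ({c - \<epsilon><..<c + \<epsilon>} - D)" using assms(2) by (intro open_Diff finite_imp_closed) auto
  moreover have "{c - \<epsilon><..<c + \<epsilon>} - D \<noteq> {}"
  proof -
    have "infinite ({c - \<epsilon><..<c + \<epsilon>} - D)"
      using assms by (intro Diff_infinite_finite infinite_Ioo) auto
    then show ?thesis by (metis finite.emptyI)
  qed
  ultimately have "({c - \<epsilon><..<c + \<epsilon>} - D) \<inter> G \<noteq> {}"
    using open_Int_closure_eq_empty[of "{c - \<epsilon><..<c + \<epsilon>} - D" G] assms(1) by simp
  then obtain x where "x \<in> G" "c - \<epsilon> < x" "x < c + \<epsilon>" "x \<notin> D" by auto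
  then show ?thesis by (intro bexI[of _ x]) auto
qed

text \<open>Coordinates are chosen one at a time; each must avoid \<open>D\<close> and its
  translates by the earlier coordinates, a finite set in all. Density is asked only for
  \<open>0 < d\<close>, so a trivial valuation stays allowed when there are no variables.\<close>

lemma generic_approximation:
  fixes G :: "real set" and r :: "nat \<Rightarrow> real"
  assumes dense: "0 < d \<Longrightarrow> closure G = UNIV" and D: "finite D" and \<epsilon>: "0 < \<epsilon>"
  shows "\<exists>\<rho>. (\<forall>j<d. \<rho> j \<in> G \<and> \<bar>\<rho> j - r j\<bar> < \<epsilon> \<and> \<rho> j \<notin> D) \<and> (\<forall>j<d. \<forall>j'<j. \<rho> j - \<rho> j' \<notin> D)"
  using dense
proof (induction d)
  case (Suc d)
  then obtain \<rho> where \<rho>: "\<forall>j<d. \<rho> j \<in> G \<and> \<bar>\<rho> j - r j\<bar> < \<epsilon> \<and> \<rho> j \<notin> D" "\<forall>j<d. \<forall>j'<j. \<rho> j - \<rho> j' \<notin> D"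
    by blast
  define D' where "D' = D \<union> (\<Union>j<d. (+) (\<rho> j) ` D)"
  have "finite D'" using D by (simp add: D'_def)
  then obtain x where x: "x \<in> G" "\<bar>x - r d\<bar> < \<epsilon>" "x \<notin> D'"
    using dense_avoids_finite[OF _ _ \<epsilon>, of G D' "r d"] Suc.prems by auto
  have "x - \<rho> j \<notin> D" if "j < d" for j
  proof
    assume "x - \<rho> j \<in> D"
    then have "\<rho> j + (x - \<rho> j) \<in> (+) (\<rho> j) ` D" by blast
    then show False using x(3) that by (auto simp: D'_def)
  qed
  then show ?case using \<rho> x
    by (intro exI[of _ "\<rho>(d := x)"]) (auto simp: less_Suc_eq D'_def)
qed simp

context
  fixes v :: "'k::field \<Rightarrow> ereal"
  assumes v: "nonarch_valuation v"
begin

text \<open>Passes to a real minimum over the nonzero coefficients. The constant term is treated as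
  a monomial of index \<open>m - 1\<close> whose coordinate is 0.\<close>

lemma trop_form_eq_Min:
  assumes m: "1 \<le> m" and r: "r (m-1) = 0" and nz: "\<exists>j<m. c i j \<noteq> 0"
  shows "trop_form v m c i r = ereal (Min ((\<lambda>j. val v (c i j) + r j) ` {j. j < m \<and> c i j \<noteq> 0}))"
proof -
  let ?J = "{j. j < m \<and> c i j \<noteq> 0}"
  let ?\<mu> = "Min ((\<lambda>j. val v (c i j) + r j) ` ?J)"
  have term_eq: "v (c i j) + ereal (r j) = ereal (val v (c i j) + r j)" if "c i j \<noteq> 0" for j
    using ereal_val[OF v that] by (metis plus_ereal.simps(1))
  have "insert (v (c i (m-1))) ((\<lambda>j. v (c i j) + ereal (r j)) ` {..<m-1}) =
    (\<lambda>j. v (c i j) + ereal (r j)) ` {..<m}"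
  proof -
    have "{..<m} = insert (m-1) {..<m-1}" using m by auto
    then show ?thesis using r by (simp add: zero_ereal_def[symmetric])
  qed
  moreover have "Min ((\<lambda>j. v (c i j) + ereal (r j)) ` {..<m}) = ereal ?\<mu>"
  proof (rule Min_eqI)
    fix t assume "t \<in> (\<lambda>j. v (c i j) + ereal (r j)) ` {..<m}"
    then obtain j where j: "j < m" "t = v (c i j) + ereal (r j)" by auto
    show "ereal ?\<mu> \<le> t"
    proof (cases "c i j = 0")
      case True
      then show ?thesis using j by (simp add: val_zero[OF v])
    next
      case False
      then show ?thesis using j by (simp add: term_eq)
    qed
  next
    have "?\<mu> \<in> (\<lambda>j. val v (c i j) + r j) ` ?J" using nz by (intro Min_in) auto
    then obtain j where "j < m" "c i j \<noteq> 0" "?\<mu> = val v (c i j) + r j" by blast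
    then show "ereal ?\<mu> \<in> (\<lambda>j. v (c i j) + ereal (r j)) ` {..<m}" using term_eq by force
  qed simp
  ultimately show ?thesis by (simp add: trop_form_def)
qed

lemma trop_map_eq_Min:
  assumes m: "1 \<le> m" and r: "r \<in> topspace (Euclidean_space (m-1))"
    and nz: "\<And>i. i < N \<Longrightarrow> \<exists>j<m. c i j \<noteq> 0"
  shows "trop_map v N m \<beta> c r = (\<lambda>l. if l < m
    then \<Sum>i<N. real_of_int (\<beta> i l) * Min ((\<lambda>j. val v (c i j) + r j) ` {j. j < m \<and> c i j \<noteq> 0}) else 0)"
  using m r nz by (auto simp: trop_map_def trop_form_eq_Min topspace_Euclidean_space fun_eq_iff)

lemma closed_trop_map_image:
  assumes m: "1 \<le> m" and nz: "\<And>i. i < N \<Longrightarrow> \<exists>j<m. c i j \<noteq> 0"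
  shows "closed (trop_map v N m \<beta> c ` topspace (Euclidean_space (m-1)))"
proof -
  have "trop_map v N m \<beta> c ` topspace (Euclidean_space (m-1)) = (\<lambda>r l. if l < m
    then \<Sum>i<N. real_of_int (\<beta> i l) * Min ((\<lambda>j. val v (c i j) + r j) ` {j. j < m \<and> c i j \<noteq> 0}) else 0) `
    {r. \<forall>j\<ge>m-1. r j = 0}"
    by (rule image_cong) (simp_all add: topspace_Euclidean_space trop_map_eq_Min[OF m _ nz])
  also have "closed \<dots>" using nz by (intro closed_image_linear_of_minima) auto
  finally show ?thesis .
qed

text \<open>Where no two monomials tie, nothing cancels, so valuation and tropicalization
  agree.\<close>

lemma val_aff_form_generic:
  assumes m: "1 \<le> m" and nz: "\<exists>j<m. c i j \<noteq> 0"
    and \<rho>: "\<And>j. j < m - 1 \<Longrightarrow> x j \<noteq> 0 \<and> \<rho> j = val v (x j)" "\<rho> (m-1) = 0"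
    and distinct: "inj_on (\<lambda>j. val v (c i j) + \<rho> j) {j. j < m \<and> c i j \<noteq> 0}"
  shows "v (aff_form m c i x) = trop_form v m c i \<rho>"
proof -
  let ?J = "{j. j < m \<and> c i j \<noteq> 0}"
  \<comment> \<open>The constant term is the monomial at \<open>m - 1\<close> with variable value 1,
    matching \<open>\<rho> (m-1) = 0\<close>.\<close>
  define f where "f = (\<lambda>j. c i j * (if j = m - 1 then 1 else x j))"
  have "aff_form m c i x = (\<Sum>j<m. f j)"
  proof -
    have "{..<m} = insert (m-1) {..<m-1}" using m by auto
    then show ?thesis by (simp add: aff_form_def f_def add.commute)
  qed
  also have "\<dots> = sum f ?J" by (rule sum.mono_neutral_right) (auto simp: f_def)
  finally have aff: "aff_form m c i x = sum f ?J" .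
  have vf: "v (f j) = ereal (val v (c i j) + \<rho> j)" if "j \<in> ?J" for j
  proof (cases "j = m - 1")
    case True
    then show ?thesis using that \<rho>(2) by (simp add: f_def ereal_val[OF v])
  next
    case False
    then have "j < m - 1" using that by auto
    then have "x j \<noteq> 0" "\<rho> j = val v (x j)" using \<rho>(1) by auto
    then show ?thesis using False that
      by (simp add: f_def val_mult[OF v] ereal_val[OF v] flip: plus_ereal.simps(1))
  qed
  have "v (sum f ?J) = Min ((\<lambda>j. v (f j)) ` ?J)"
  proof (rule val_sum_distinct[OF v])
    show "inj_on (\<lambda>j. v (f j)) ?J" using distinct by (auto simp: inj_on_def vf)
  qed (use nz in auto)
  also have "\<dots> = Min (ereal ` (\<lambda>j. val v (c i j) + \<rho> j) ` ?J)"
    unfolding image_image by (intro arg_cong[of _ _ Min] image_cong) (simp_all add: vf)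
  also have "\<dots> = ereal (Min ((\<lambda>j. val v (c i j) + \<rho> j) ` ?J))"
    by (rule mono_Min_commute[symmetric]) (use nz in \<open>auto simp: mono_def\<close>)
  finally show ?thesis using trop_form_eq_Min[of m \<rho> c i] m nz \<rho>(2) aff by simp
qed

lemma trop_map_approximation:
  fixes c :: "nat \<Rightarrow> nat \<Rightarrow> 'k"
  assumes m: "1 \<le> m" and nz: "\<And>i. i < N \<Longrightarrow> \<exists>j<m. c i j \<noteq> 0"
    and dense: "2 \<le> m \<Longrightarrow> closure ((\<lambda>x. real_of_ereal (v x)) ` (- {0})) = UNIV"
    and \<epsilon>: "0 < \<epsilon>"
  shows "\<exists>\<rho>\<in>topspace (Euclidean_space (m-1)). (\<forall>j<m-1. \<bar>\<rho> j - r j\<bar> < \<epsilon>) \<and>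
    trop_map v N m \<beta> c \<rho> \<in> param_map v N m \<beta> c ` form_domain N m c"
proof -
  \<comment> \<open>A tie between monomials \<open>j\<close> and \<open>j'\<close> of form
    \<open>i\<close> puts \<open>\<rho> j - \<rho> j'\<close> into this finite set. Column
    \<open>m - 1\<close> is included, so avoiding \<open>D\<close> also excludes ties with the
    constant term.\<close>
  define D where "D = (\<lambda>(i, j, j'). val v (c i j') - val v (c i j)) ` ({..<N} \<times> {..<m} \<times> {..<m})"
  have D: "finite D" "\<And>i j j'. i < N \<Longrightarrow> j < m \<Longrightarrow> j' < m \<Longrightarrow> val v (c i j') - val v (c i j) \<in> D"
    by (force simp: D_def)+
  have dense': "closure (val v ` (- {0})) = UNIV" if "0 < m - 1"
    using dense that by (simp add: val_def[OF v, abs_def])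
  from generic_approximation[where d = "m - 1" and r = r, OF dense' D(1) \<epsilon>]
  obtain \<rho>0 where \<rho>0: "\<And>j. j < m - 1 \<Longrightarrow> \<rho>0 j \<in> val v ` (- {0}) \<and> \<bar>\<rho>0 j - r j\<bar> < \<epsilon> \<and> \<rho>0 j \<notin> D"
    "\<And>j j'. j < m - 1 \<Longrightarrow> j' < j \<Longrightarrow> \<rho>0 j - \<rho>0 j' \<notin> D"
    by auto
  have "\<forall>j. \<exists>z. j < m - 1 \<longrightarrow> z \<noteq> 0 \<and> \<rho>0 j = val v z" using \<rho>0(1) by fastforce
  then obtain x0 where x0: "\<And>j. j < m - 1 \<Longrightarrow> x0 j \<noteq> 0 \<and> \<rho>0 j = val v (x0 j)"
    by metis
  define x where "x = (\<lambda>j. if j < m - 1 then x0 j else 0)"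
  define \<rho> where "\<rho> = (\<lambda>j. if j < m - 1 then \<rho>0 j else 0)"
  have \<rho>_in: "\<rho> \<in> topspace (Euclidean_space (m-1))" by (simp add: \<rho>_def topspace_Euclidean_space)
  \<comment> \<open>Needed for ties with the constant term, where the difference is
    \<open>- \<rho>0 j'\<close>.\<close>
  have minus_D: "t \<in> D" if "- t \<in> D" for t using that by (force simp: D_def)
  have diff: "\<rho> j - \<rho> j' \<notin> D" if "j' < j" "j < m" for j j'
  proof (cases "j = m - 1")
    case True
    then have "\<rho> j - \<rho> j' = - \<rho>0 j'" "\<rho>0 j' \<notin> D" using that \<rho>0(1)[of j'] by (simp_all add: \<rho>_def)
    then show ?thesis using minus_D by metis
  next
    case False
    then have "j < m - 1" "j' < m - 1" using that by auto
    then show ?thesis using that \<rho>0(2) by (simp add: \<rho>_def)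
  qed
  have inj: "inj_on (\<lambda>j. val v (c i j) + \<rho> j) {j. j < m \<and> c i j \<noteq> 0}" if i: "i < N" for i
  proof (rule linorder_inj_onI')
    fix j' j assume j: "j' \<in> {j. j < m \<and> c i j \<noteq> 0}" "j \<in> {j. j < m \<and> c i j \<noteq> 0}" "j' < j"
    show "val v (c i j') + \<rho> j' \<noteq> val v (c i j) + \<rho> j"
    proof
      assume "val v (c i j') + \<rho> j' = val v (c i j) + \<rho> j"
      then have "\<rho> j - \<rho> j' = val v (c i j') - val v (c i j)" by simp
      then show False using D(2)[OF i, of j j'] diff[OF j(3)] j by simp
    qed
  qed
  have x\<rho>: "x j \<noteq> 0 \<and> \<rho> j = val v (x j)" if "j < m - 1" for j
    using x0[OF that] that by (simp add: x_def \<rho>_def)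
  have aff: "v (aff_form m c i x) = trop_form v m c i \<rho>" if "i < N" for i
    by (rule val_aff_form_generic[where c = c and x = x and \<rho> = \<rho>, OF m nz[OF that] x\<rho> _ inj[OF that]])
      (auto simp: \<rho>_def)
  \<comment> \<open>The valuation equals a real minimum, hence is finite.\<close>
  have "aff_form m c i x \<noteq> 0" if "i < N" for i
    using aff[OF that] trop_form_eq_Min[OF m, of \<rho> c i] nz[OF that] val_eq_PInf[OF v, of "aff_form m c i x"]
    by (simp add: \<rho>_def)
  then have "x \<in> form_domain N m c" by (simp add: form_domain_def kspace_def x_def)
  moreover have "trop_map v N m \<beta> c \<rho> = param_map v N m \<beta> c x"
    by (auto simp: trop_map_def param_map_def aff fun_eq_iff)
  moreover have "\<forall>j<m-1. \<bar>\<rho> j - r j\<bar> < \<epsilon>" using \<rho>0(1) by (simp add: \<rho>_def)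
  ultimately show ?thesis using \<rho>_in by (intro bexI[of _ \<rho>]) auto
qed

text \<open>The tropical map is built from minima of translated coordinates, hence continuous, so
  its values at generic approximations of \<open>r\<close> converge to its value at
  \<open>r\<close>.\<close>

lemma trop_map_in_closure:
  fixes c :: "nat \<Rightarrow> nat \<Rightarrow> 'k"
  assumes m: "1 \<le> m" and nz: "\<And>i. i < N \<Longrightarrow> \<exists>j<m. c i j \<noteq> 0"
    and dense: "2 \<le> m \<Longrightarrow> closure ((\<lambda>x. real_of_ereal (v x)) ` (- {0})) = UNIV"
    and r: "r \<in> topspace (Euclidean_space (m-1))"
  shows "trop_map v N m \<beta> c r \<in> closure (param_map v N m \<beta> c ` form_domain N m c)"
proof -
  have "\<exists>\<rho>\<in>topspace (Euclidean_space (m-1)). (\<forall>j<m-1. \<bar>\<rho> j - r j\<bar> < inverse (real (Suc n))) \<and>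
    trop_map v N m \<beta> c \<rho> \<in> param_map v N m \<beta> c ` form_domain N m c" for n
    by (rule trop_map_approximation[OF m nz dense]) auto
  then obtain \<rho> where \<rho>: "\<And>n. \<rho> n \<in> topspace (Euclidean_space (m-1))"
    "\<And>n j. j < m - 1 \<Longrightarrow> \<bar>\<rho> n j - r j\<bar> < inverse (real (Suc n))"
    "\<And>n. trop_map v N m \<beta> c (\<rho> n) \<in> param_map v N m \<beta> c ` form_domain N m c" by metis
  have lim: "(\<lambda>n. \<rho> n j) \<longlonglongrightarrow> r j" for j
  proof (cases "j < m - 1")
    case True
    have "(\<lambda>n. \<rho> n j - r j) \<longlonglongrightarrow> 0"
      by (rule Lim_null_comparison[OF _ LIMSEQ_inverse_real_of_nat])
        (use \<rho>(2)[OF True] in \<open>simp add: less_imp_le\<close>)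
    then show ?thesis by (simp add: LIM_zero_iff)
  next
    case False
    then show ?thesis using \<rho>(1) r by (simp add: topspace_Euclidean_space)
  qed
  have trop_lim: "(\<lambda>n. trop_map v N m \<beta> c (\<rho> n)) \<longlonglongrightarrow> trop_map v N m \<beta> c r"
  proof (rule tendsto_funI)
    fix l
    have "(\<lambda>n. Min ((\<lambda>j. val v (c i j) + \<rho> n j) ` {j. j < m \<and> c i j \<noteq> 0}))
      \<longlonglongrightarrow> Min ((\<lambda>j. val v (c i j) + r j) ` {j. j < m \<and> c i j \<noteq> 0})" if "i < N" for i
      using nz[OF that] by (intro tendsto_Min_image tendsto_intros lim) auto
    then have "(\<lambda>n. \<Sum>i<N. real_of_int (\<beta> i l) * Min ((\<lambda>j. val v (c i j) + \<rho> n j) ` {j. j < m \<and> c i j \<noteq> 0}))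
      \<longlonglongrightarrow> (\<Sum>i<N. real_of_int (\<beta> i l) * Min ((\<lambda>j. val v (c i j) + r j) ` {j. j < m \<and> c i j \<noteq> 0}))"
      by (intro tendsto_sum tendsto_mult tendsto_const) simp
    then show "(\<lambda>n. trop_map v N m \<beta> c (\<rho> n) l) \<longlonglongrightarrow> trop_map v N m \<beta> c r l"
      by (simp add: trop_map_eq_Min[OF m \<rho>(1) nz] trop_map_eq_Min[OF m r nz])
  qed
  have "\<forall>\<^sub>F n in sequentially. trop_map v N m \<beta> c (\<rho> n) \<in> closure (param_map v N m \<beta> c ` form_domain N m c)"
    using \<rho>(3) closure_subset by (intro always_eventually) blast
  then show ?thesis by (rule Lim_in_closed_set[OF closed_closure _ sequentially_bot trop_lim])
qed

end

section \<open>The discriminant amoeba\<close>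

text \<open>A form that vanishes identically in the new coordinates vanishes in the old ones. This
  keeps the index sets of the real minima nonempty.\<close>

lemma chart_coeffs_row_nonzero:
  assumes I: "I \<in> chart_sets N m b" and m: "1 \<le> m" and i: "i < N" and b: "\<exists>j<m. b i j \<noteq> 0"
  shows "\<exists>j<m. chart_coeffs N m b I i j \<noteq> 0"
proof (rule ccontr)
  assume "\<not> ?thesis"
  then have zero: "aff_form m (chart_coeffs N m b I) i y = 0" for y using m by (simp add: aff_form_def)
  have "b i j = (\<lambda>_ _. 0) i j" if "j < m" for j
  proof (rule aff_form_eq_imp_coeff_eq[OF _ that])
    fix x :: "nat \<Rightarrow> 'a" assume "x \<in> kspace (m-1)"
    then show "aff_form m b i x = aff_form m (\<lambda>_ _. 0) i x"
      using aff_form_chart_coeffs[OF I i] zero by (simp add: aff_form_def[of m "\<lambda>_ _. 0"])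
  qed
  with b show False by blast
qed

text \<open>Chart coordinates are surjective and the forms keep their values, while the outer
  coefficients \<open>\<beta>\<close> are unchanged.\<close>

lemma param_map_chart_subset:
  assumes I: "I \<in> chart_sets N m b"
  shows "param_map v N m \<beta> (chart_coeffs N m b I) ` form_domain N m (chart_coeffs N m b I) \<subseteq>
    param_map v N m \<beta> b ` form_domain N m b"
proof (rule image_subsetI)
  fix y assume y: "y \<in> form_domain N m (chart_coeffs N m b I)"
  then obtain x where x: "x \<in> kspace (m-1)" "chart_coords m b I x = y"
    using chart_coords_surjective[OF I, of y] by (auto simp: form_domain_def)
  have aff: "aff_form m (chart_coeffs N m b I) i y = aff_form m b i x" if "i < N" for i
    using aff_form_chart_coeffs[OF I that x(1)] x(2) by simp
  then have "x \<in> form_domain N m b" using x(1) y by (simp add: form_domain_def)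
  moreover have "param_map v N m \<beta> (chart_coeffs N m b I) y = param_map v N m \<beta> b x"
    by (auto simp: param_map_def aff fun_eq_iff)
  ultimately show "param_map v N m \<beta> (chart_coeffs N m b I) y \<in> param_map v N m \<beta> b ` form_domain N m b"
    by blast
qed

text \<open>
  The chart is an integral basis \<open>S\<close> of the linear parts of the rescaled forms \<open>f\<^sub>i / f\<^sub>i(x)\<close>, and the
  tropical point has coordinates \<open>v(f\<^sub>s(x))\<close> for \<open>s \<in> S\<close>: integrality is exactly the inequality
  \<open>v(f\<^sub>i(x)) \<le> v(\<beta>\<^sup>*\<^sub>i\<^sub>s) + v(f\<^sub>s(x))\<close>.
\<close>

lemma param_map_in_trop_map_image:
  fixes b :: "nat \<Rightarrow> nat \<Rightarrow> 'k::field"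
  assumes v: "nonarch_valuation v" and m: "1 \<le> m"
    and inj: "\<And>y. \<forall>i<N. (\<Sum>j<m. b i j * y j) = 0 \<Longrightarrow> \<forall>j<m. y j = 0"
    and x: "x \<in> form_domain N m b"
  shows "\<exists>I\<in>chart_sets N m b. param_map v N m \<beta> b x \<in>
    trop_map v N m \<beta> (chart_coeffs N m b I) ` topspace (Euclidean_space (m-1))"
proof -
  define f where "f = (\<lambda>i. aff_form m b i x)"
  have f: "f i \<noteq> 0" if "i < N" for i using x that by (simp add: form_domain_def f_def)
  obtain S where S: "S \<subseteq> {..<N}" and
    comb: "\<And>i. i \<in> {..<N} \<Longrightarrow> \<exists>e. (\<forall>s\<in>S. 0 \<le> v (e s)) \<and> (\<forall>l\<in>{..<m-1}. b i l / f i = (\<Sum>s\<in>S. e s * (b s l / f s)))" and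
    indep: "\<And>e. \<forall>l\<in>{..<m-1}. (\<Sum>s\<in>S. e s * (b s l / f s)) = 0 \<Longrightarrow> \<forall>s\<in>S. e s = 0"
    by (rule integral_basis[OF v, of "{..<N}" "{..<m-1}" "\<lambda>i l. b i l / f i"]) auto
  have "finite S" using S finite_subset by blast
  have rows: "\<exists>e. (\<forall>s\<in>S. 0 \<le> v (e s)) \<and> (\<forall>l<m-1. b i l = (\<Sum>s\<in>S. (e s * f i / f s) * b s l))" if i: "i < N" for i
  proof -
    from i have "i \<in> {..<N}" by simp
    from comb[OF this] obtain e where e: "\<forall>s\<in>S. 0 \<le> v (e s)"
      "\<forall>l\<in>{..<m-1}. b i l / f i = (\<Sum>s\<in>S. e s * (b s l / f s))" by blast
    have "b i l = (\<Sum>s\<in>S. (e s * f i / f s) * b s l)" if "l < m - 1" for l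
    proof -
      have "b i l = f i * (b i l / f i)" using f[OF i] by simp
      also have "\<dots> = (\<Sum>s\<in>S. (e s * f i / f s) * b s l)" using e(2) that by (simp add: sum_distrib_left ac_simps)
      finally show ?thesis .
    qed
    then show ?thesis using e(1) by (intro exI[of _ e]) simp
  qed
  have kernel: "\<forall>l<m-1. y l = 0" if y: "\<forall>s\<in>S. (\<Sum>l<m-1. b s l * y l) = 0" for y
  proof -
    \<comment> \<open>The appended zero meets the constant terms, so a vector annihilated by the
      linear parts becomes a kernel vector of the full matrix \<open>b\<close>.\<close>
    define y' where "y' = (\<lambda>l. if l < m - 1 then y l else 0)"
    have "(\<Sum>l<m. b i l * y' l) = 0" if i: "i < N" for i
    proof -
      obtain e where e: "\<And>l. l < m - 1 \<Longrightarrow> b i l = (\<Sum>s\<in>S. (e s * f i / f s) * b s l)"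
        using rows[OF i] by blast
      have "{..<m} = insert (m-1) {..<m-1}" using m by auto
      then have "(\<Sum>l<m. b i l * y' l) = (\<Sum>l<m-1. b i l * y l)" by (simp add: y'_def)
      also have "\<dots> = (\<Sum>l<m-1. \<Sum>s\<in>S. (e s * f i / f s) * (b s l * y l))"
        by (rule sum.cong) (simp_all add: e sum_distrib_right mult.assoc)
      also have "\<dots> = (\<Sum>s\<in>S. (e s * f i / f s) * (\<Sum>l<m-1. b s l * y l))"
        by (subst sum.swap) (simp add: sum_distrib_left)
      also have "\<dots> = 0" using y by simp
      finally show ?thesis .
    qed
    then have y'_zero: "\<forall>l<m. y' l = 0" by (intro inj) blast
    show ?thesis
    proof (intro allI impI)
      fix l assume l: "l < m - 1"
      then have "l < m" by simp
      then have "y' l = 0" using y'_zero by blast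
      then show "y l = 0" using l by (simp add: y'_def)
    qed
  qed
  \<comment> \<open>Independence of the linear parts bounds \<open>card S\<close> from above,
    triviality of their common kernel from below.\<close>
  have "card S \<le> m - 1"
  proof (rule ccontr)
    assume "\<not> card S \<le> m - 1"
    then have "\<exists>u. (\<exists>s\<in>S. u s \<noteq> 0) \<and> (\<forall>l\<in>{..<m-1}. (\<Sum>s\<in>S. (b s l / f s) * u s) = 0)"
      using \<open>finite S\<close> by (intro nontrivial_solution) auto
    then show False using indep by (force simp: mult.commute)
  qed
  moreover have "m - 1 \<le> card S"
  proof (rule ccontr)
    assume "\<not> m - 1 \<le> card S"
    then have "\<exists>u. (\<exists>l\<in>{..<m-1}. u l \<noteq> 0) \<and> (\<forall>s\<in>S. (\<Sum>l\<in>{..<m-1}. b s l * u l) = 0)"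
      using \<open>finite S\<close> by (intro nontrivial_solution) auto
    then show False using kernel by blast
  qed
  ultimately have I: "S \<in> chart_sets N m b" using S kernel by (intro chart_setsI) auto
  define L where "L = (\<lambda>j. sorted_list_of_set S ! j)"
  have L: "L j \<in> S" if "j < m - 1" for j
    using chart_index_bij[OF I] that by (auto simp: bij_betw_def L_def)
  define r where "r = (\<lambda>j. if j < m - 1 then val v (f (L j)) else 0)"
  let ?c = "chart_coeffs N m b S"
  let ?y = "chart_coords m b S x"
  have y: "?y j = f (L j)" if "j < m - 1" for j using that by (simp add: chart_coords_def f_def L_def)
  have aff: "aff_form m ?c i ?y = f i" if "i < N" for i
    using aff_form_chart_coeffs[OF I that] x by (simp add: f_def form_domain_def)
  have "trop_form v m ?c i r = v (aff_form m ?c i ?y)" if i: "i < N" for i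
  proof (rule trop_form_eq_val[OF v])
    fix j assume j: "j < m - 1"
    have fL: "f (L j) \<noteq> 0" using f L[OF j] S by blast
    then show "?y j \<noteq> 0 \<and> r j = val v (?y j)" using j by (simp add: y r_def)
    obtain e where e: "\<forall>s\<in>S. 0 \<le> v (e s)" "\<And>l. l < m - 1 \<Longrightarrow> b i l = (\<Sum>s\<in>S. (e s * f i / f s) * b s l)"
      using rows[OF i] by blast
    have "?c i j = e (L j) * f i / f (L j)"
      unfolding L_def by (rule chart_coeffs_eqI[OF I i j e(2)])
    then show "v (aff_form m ?c i ?y) \<le> v (?c i j) + v (?y j)"
      using val_divide_mult[OF v fL, of "e (L j)" "f i"] e(1) L[OF j] by (simp add: aff[OF i] y[OF j])
  qed
  then have "param_map v N m \<beta> b x = trop_map v N m \<beta> ?c r"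
    by (auto simp: param_map_def trop_map_def aff fun_eq_iff f_def)
  moreover have "r \<in> topspace (Euclidean_space (m-1))" by (simp add: r_def topspace_Euclidean_space)
  ultimately show ?thesis using I by blast
qed

text \<open>\<open>dense_values\<close> supplies enough points over the value group once there is a
  variable, that is, for \<open>2 \<le> m\<close>. \<open>nonzero_forms\<close> matters in positive
  characteristic, where a nonzero integer row can become zero in \<open>k\<close>.\<close>

theorem theorem1:
  fixes v :: "'k::field \<Rightarrow> ereal"
    and a :: "nat \<Rightarrow> int ^ 'n"
    and \<beta> :: "nat \<Rightarrow> nat \<Rightarrow> int"
    and m N :: nat
    and b :: "nat \<Rightarrow> nat \<Rightarrow> 'k"
  defines "N \<equiv> CARD('n) + m + 1"
    and "b \<equiv> \<lambda>i j. of_int (\<beta> i j)"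
  assumes val: "nonarch_valuation v"
    and m: "1 \<le> m"
    and gen: "general_position N a"
    and B: "columns_basis_of_null_lattice N m a \<beta>"
    and dense_values: "2 \<le> m \<Longrightarrow> closure ((\<lambda>x. real_of_ereal (v x)) ` (- {0})) = UNIV"
    and nonzero_forms: "\<And>i. i < N \<Longrightarrow> \<exists>j<m. \<beta> i j \<noteq> 0 \<Longrightarrow> \<exists>j<m. b i j \<noteq> 0"
  shows "Euclidean_space m closure_of (param_map v N m \<beta> b ` form_domain N m b) =
         (\<Union>I \<in> chart_sets N m b.
            trop_map v N m \<beta> (chart_coeffs N m b I) ` topspace (Euclidean_space (m - 1)))"
    (is "_ = ?trop")
proof -
  let ?image = "param_map v N m \<beta> b ` form_domain N m b"
  have "CARD('n) + 2 \<le> N" using m by (simp add: N_def)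
  then have b_nz: "\<exists>j<m. b i j \<noteq> 0" if "i < N" for i
    using nonzero_forms[OF that] null_basis_row_nonzero[OF B gen] that by blast
  have b_inj: "\<forall>j<m. y j = 0" if "\<forall>i<N. (\<Sum>j<m. b i j * y j) = 0" for y
    using null_basis_injective[OF B] that by (simp add: b_def)
  have c_nz: "\<exists>j<m. chart_coeffs N m b I i j \<noteq> 0" if "I \<in> chart_sets N m b" "i < N" for I i
    using chart_coeffs_row_nonzero[OF that(1) m that(2) b_nz[OF that(2)]] .
  \<comment> \<open>\<open>Euclidean_space m\<close> is a subspace of the product space of real
    sequences, and a closed one, so both closures of the image agree.\<close>
  have "?image \<subseteq> {y. \<forall>l\<ge>m. y l = 0}" by (auto simp: param_map_def)
  then have "{y. \<forall>l\<ge>m. y l = 0} \<inter> ?image = ?image" "closure ?image \<subseteq> {y. \<forall>l\<ge>m. y l = 0}"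
    using closure_minimal closed_vanishing_tail by blast+
  then have closure_of: "Euclidean_space m closure_of ?image = closure ?image"
    unfolding Euclidean_space_def closure_of_subtopology
    by (simp add: euclidean_product_topology Int_absorb1)
  have "closure ?image \<subseteq> ?trop"
  proof (rule closure_minimal)
    show "?image \<subseteq> ?trop" using param_map_in_trop_map_image[OF val m b_inj] by blast
    have "finite (chart_sets N m b)"
      by (rule finite_subset[of _ "Pow {..<N}"]) (auto simp: chart_sets_def)
    then show "closed ?trop" using closed_trop_map_image[OF val m c_nz] by (intro closed_UN) auto
  qed
  moreover have "?trop \<subseteq> closure ?image"
  proof clarify
    fix I r assume I: "I \<in> chart_sets N m b" and r: "r \<in> topspace (Euclidean_space (m-1))"
    have "trop_map v N m \<beta> (chart_coeffs N m b I) r \<in>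
      closure (param_map v N m \<beta> (chart_coeffs N m b I) ` form_domain N m (chart_coeffs N m b I))"
      by (rule trop_map_in_closure[OF val m c_nz[OF I] dense_values r])
    then show "trop_map v N m \<beta> (chart_coeffs N m b I) r \<in> closure ?image"
      using closure_mono[OF param_map_chart_subset[OF I]] by blast
  qed
  ultimately show ?thesis unfolding closure_of by blast
qed

end
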